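(* There are infinitely many $3$-dimensional convex polytopes which are only $3$-connected (that is, whose $1$-skeleton is $3$-connected but not $4$-connected) and which have at least one gap in their sequence of the number of vertices of slices (their vertex slice sequence).
   Context: For a $d$-dimensional convex polytope $P\subset\mathbb{R}^d$, let $\mathcal{H}_P$ be the set of affine hyperplanes $H$ with $H\cap P\neq\emptyset$, let $cv_P(H)=|V(H\cap P)|$ be the number of vertices of the slice $H\cap P$, and let $\nu(P)=\max_{H\in\mathcal{H}_P}cv_P(H)$. The vertex slice sequence of $P$ is the sequence of values in the image $VSS(P)=cv_P(\mathcal{H}_P)$. A gap of $P$ is an integer $m$ with $1\le m\le\nu(P)$ and $m\notin VSS(P)$. The $1$-skeleton of $P$ is the graph formed by its vertices and edges. *)

theory Defs
  imports "Graph_Theory.Digraph_Component" "HOL-Analysis.Analysis"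
begin

definition vertices :: "'a::euclidean_space set \<Rightarrow> 'a set" where
  "vertices P = {v. v extreme_point_of P}"

definition affine_hyperplane :: "'a::euclidean_space set \<Rightarrow> bool" where
  "affine_hyperplane H \<longleftrightarrow> (\<exists>a b. a \<noteq> 0 \<and> H = {x. a \<bullet> x = b})"

definition slicing_hyperplanes :: "'a::euclidean_space set \<Rightarrow> 'a set set" where
  "slicing_hyperplanes P = {H. affine_hyperplane H \<and> H \<inter> P \<noteq> {}}"

definition cv :: "'a::euclidean_space set \<Rightarrow> 'a set \<Rightarrow> nat" where
  "cv P H = card (vertices (H \<inter> P))"

definition VSS :: "'a::euclidean_space set \<Rightarrow> nat set" where
  "VSS P = cv P ` slicing_hyperplanes P"

(* For a polytope the maximum exists: every vertex of a slice H \<inter> P is the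
   intersection of H with a face of P, so the number of faces bounds VSS P. *)
definition max_slice :: "'a::euclidean_space set \<Rightarrow> nat" where
  "max_slice P = Max (VSS P)"

definition is_gap :: "'a::euclidean_space set \<Rightarrow> nat \<Rightarrow> bool" where
  "is_gap P m \<longleftrightarrow> 1 \<le> m \<and> m \<le> max_slice P \<and> m \<notin> VSS P"

(* As usual in Graph_Theory, an undirected edge {u, v} is the pair of arcs (u, v), (v, u). *)
definition skeleton :: "'a::euclidean_space set \<Rightarrow> 'a pair_pre_digraph" where
  "skeleton P =
     \<lparr> pverts = vertices P, parcs = {(u, v). closed_segment u v edge_of P} \<rparr>"

(* Vertex connectivity of a finite graph. The name connected is qualified because it
   otherwise denotes topological connectedness. *)
definition k_connected :: "nat \<Rightarrow> ('v, 'e) pre_digraph \<Rightarrow> bool" where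
  "k_connected k G \<longleftrightarrow>
     k < card (verts G) \<and>
     (\<forall>X \<subseteq> verts G. card X < k \<longrightarrow> Digraph_Component.connected (G \<restriction> (verts G - X)))"

(* Isomorphism of face lattices. Both the empty face and the polytope itself satisfy face_of. *)
definition combinatorially_equivalent ::
    "'a::euclidean_space set \<Rightarrow> 'b::euclidean_space set \<Rightarrow> bool" where
  "combinatorially_equivalent P Q \<longleftrightarrow>
     (\<exists>f. bij_betw f {F. F face_of P} {F. F face_of Q} \<and>
          (\<forall>F G. F face_of P \<longrightarrow> G face_of P \<longrightarrow> (F \<subseteq> G \<longleftrightarrow> f F \<subseteq> f G)))"

end

theory Submission
  imports Defs
begin

text \<open>
  The polytopes are bipyramids with one extra vertex. Take a convex polygon with the vertices
  \<open>p\<^sub>t = (t, t\<^sup>2, 0)\<close> for \<open>0 \<le> t \<le> n\<close>, and two apices \<open>A\<close>, \<open>B\<close> above and below it whose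
  midpoint \<open>M\<close> lies in the polygon, close to \<open>p\<^sub>0\<close>. A plane that has an apex on it or separates the
  apices meets at most one of the two spokes at each \<open>p\<^sub>t\<close>, so its slice has at most \<open>n\<close> vertices, up to
  an additive constant. A plane that has both apices on one side and \<open>k\<close> of the \<open>p\<^sub>t\<close> on the other
  meets \<open>2 k\<close> spokes, and it meets the boundary of the polygon in at most two points. As \<open>M\<close> is close
  to \<open>p\<^sub>0\<close>, a large \<open>k\<close> forces \<open>p\<^sub>0\<close> onto the side of the apices; so \<open>k \<le> n\<close>, and the large slices of
  this bipyramid have \<open>2 n + 2\<close> vertices for \<open>k = n\<close> and at most \<open>2 n\<close> for \<open>k < n\<close>.

  The graph of this bipyramid is 4-connected. To destroy that, a cap \<open>D\<close> is put on the facet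
  \<open>A p\<^sub>1 p\<^sub>2\<close>, in the plane of the facet \<open>B p\<^sub>1 p\<^sub>2\<close>. The edge \<open>p\<^sub>1 p\<^sub>2\<close> disappears inside the
  quadrilateral \<open>B p\<^sub>1 D p\<^sub>2\<close>, and \<open>D\<close> has the three neighbours \<open>A\<close>, \<open>p\<^sub>1\<close>, \<open>p\<^sub>2\<close>, whose removal isolates
  it. Since the diagonals \<open>B D\<close> and \<open>p\<^sub>1 p\<^sub>2\<close> of the quadrilateral cross, \<open>D\<close> is on the side of
  \<open>p\<^sub>1\<close> and \<open>p\<^sub>2\<close> as soon as these two are separated from \<open>B\<close>. Hence every plane with \<open>k = n\<close> now meets
  \<open>A D\<close> as well and yields at least \<open>2 n + 3\<close> vertices, while \<open>k < n\<close> still yields at most \<open>2 n + 1\<close>. So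
  \<open>2 n + 2\<close> is a gap (\<open>slice_count_gap\<close>).

  Two facts reduce all of this to quadratic polynomials. A slice of a polytope has one vertex for each
  vertex on the plane and one for each edge that crosses it (\<open>card_vertices_slice\<close>), so only the signs
  of an affine functional at the vertices matter, and on \<open>p\<^sub>0, \<dots>, p\<^sub>n\<close> an affine functional
  is an arbitrary quadratic polynomial in \<open>t\<close>. Two vertices span an edge if and only if some affine functional
  is zero at both and positive at all others (\<open>segment_edge_of_convex_hull_iff\<close>), which again
  is a question about quadratic polynomials. Different \<open>n\<close> give different numbers of vertices, so
  the polytopes are pairwise inequivalent.
\<close>

section \<open>Vertices of a slice of a polytope\<close>

text \<open>
  A face of least dimension that contains the point works: a point on its relative frontier would
  lie in a facet of it, which has smaller dimension.
\<close>
lemma face_containing_in_rel_interior: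
  fixes P :: "'a::euclidean_space set"
  assumes P: "polytope P" and x: "x \<in> P"
  obtains F where "F face_of P" "x \<in> rel_interior F"
proof -
  let ?fs = "{F. F face_of P \<and> x \<in> F}"
  have "P \<in> ?fs"
    using P x by (simp add: face_of_refl polytope_imp_convex)
  then obtain F where F: "F \<in> ?fs" and min: "\<And>G. G \<in> ?fs \<Longrightarrow> nat (aff_dim F) \<le> nat (aff_dim G)"
    using ex_has_least_nat[of "\<lambda>F. F \<in> ?fs" P "\<lambda>F. nat (aff_dim F)"] by blast
  have polyF: "polytope F" using F P face_of_polytope_polytope by blast
  have "x \<in> rel_interior F"
  proof (rule ccontr)
    assume "x \<notin> rel_interior F"
    then have "x \<in> rel_frontier F"
      using F polyF closure_subset unfolding rel_frontier_def by blast
    then obtain G where G: "G facet_of F" "x \<in> G"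
      using rel_frontier_of_polyhedron[OF polytope_imp_polyhedron[OF polyF]] by blast
    then have "G face_of P" using F facet_of_imp_face_of face_of_trans by blast
    moreover have "nat (aff_dim G) < nat (aff_dim F)"
      using G aff_dim_geq[of G] aff_dim_empty[of G] unfolding facet_of_def
      by auto
    ultimately show False using min[of G] G by fastforce
  qed
  then show thesis using that F by blast
qed

lemma polytope_aff_dim_1_is_segment:
  fixes F :: "'a::euclidean_space set"
  assumes "polytope F" "aff_dim F = 1"
  obtains u v where "u \<noteq> v" "F = closed_segment u v"
proof -
  obtain n where "n simplex F" using assms polytope_lowdim_imp_simplex by (metis order_refl)
  then have "1 simplex F" using aff_dim_simplex assms(2) by metis
  then obtain C where "int (card C) = 2" and F: "F = convex hull C"
    unfolding simplex_def by auto
  then have "card C = 2" by linarith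
  then obtain u v where "u \<noteq> v" "C = {u, v}" by (auto simp: card_2_iff)
  then show thesis using that[of u v] F by (simp add: segment_convex_hull)
qed

text \<open>
  The face with the point in its relative interior meets the plane in an affine section that is
  relatively open around an extreme point, hence in the point alone. So the face has dimension at
  most one.
\<close>
lemma extreme_point_of_slice_cases:
  fixes P :: "'a::euclidean_space set"
  assumes P: "polytope P" and x: "x extreme_point_of ({x. a \<bullet> x = b} \<inter> P)"
  obtains "x extreme_point_of P" "a \<bullet> x = b"
  | u v where "closed_segment u v edge_of P" "a \<bullet> u < b" "b < a \<bullet> v" "x \<in> open_segment u v"
proof -
  let ?H = "{x. a \<bullet> x = b}"
  have xP: "x \<in> P" and xH: "a \<bullet> x = b" using x by (auto simp: extreme_point_of_def)
  obtain F where F: "F face_of P" "x \<in> rel_interior F"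
    using face_containing_in_rel_interior[OF P xP] .
  have conv: "convex F" and polyF: "polytope F"
    using F P face_of_imp_convex face_of_polytope_polytope by blast+
  have xF: "x \<in> F" using F rel_interior_subset by blast
  have "rel_interior (F \<inter> ?H) = rel_interior F \<inter> ?H"
    using F xH conv by (intro convex_affine_rel_interior_Int affine_hyperplane) auto
  then have rel: "x \<in> rel_interior (F \<inter> ?H)" using F xH by auto
  have "x extreme_point_of (F \<inter> ?H)"
    using x xF xH face_of_imp_subset[OF F(1)] unfolding extreme_point_of_def by blast
  then have single: "F \<inter> ?H = {x}" using rel extreme_point_not_in_REL_INTERIOR by blast
  have aff: "affine hull F \<inter> ?H = {x}"
  proof -
    obtain e where e: "e > 0" "ball x e \<inter> affine hull F \<subseteq> F"
      using F(2) mem_rel_interior_ball by blast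
    have "y = x" if y: "y \<in> affine hull F" "a \<bullet> y = b" for y
    proof (rule ccontr)
      assume ne: "y \<noteq> x"
      define t where "t = e / (2 * norm (y - x))"
      have t: "t > 0" "t * norm (y - x) < e" using ne e by (auto simp: t_def)
      define z where "z = (1 - t) *\<^sub>R x + t *\<^sub>R y"
      have zx: "z - x = t *\<^sub>R (y - x)" by (simp add: z_def algebra_simps)
      have "z \<in> affine hull F"
        unfolding z_def using y(1) hull_inc[OF xF]
        by (intro mem_affine[OF affine_affine_hull]) auto
      moreover have "z \<in> ball x e"
        using zx t(2) \<open>t > 0\<close> by (simp add: dist_norm norm_minus_commute[of x])
      ultimately have "z \<in> F" using e by blast
      moreover have "a \<bullet> z = b" using y(2) xH by (simp add: z_def inner_simps algebra_simps)
      ultimately have "z = x" using single by blast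
      then show False using zx t ne by simp
    qed
    moreover have "x \<in> affine hull F" using xF by (rule hull_inc)
    ultimately show ?thesis using xH by blast
  qed
  show thesis
  proof (cases "affine hull F \<subseteq> ?H")
    case True
    then have "F = {x}" using aff hull_subset[of F affine] xF by blast
    then have "x extreme_point_of P" using F(1) face_of_singleton by blast
    then show thesis using that(1) xH by blast
  next
    case False
    then have "aff_dim F = 1"
      using aff_dim_affine_Int_hyperplane[OF affine_affine_hull, of F a b] aff by auto
    moreover obtain u v where uv: "u \<noteq> v" "F = closed_segment u v"
      using polytope_aff_dim_1_is_segment polyF calculation by blast
    ultimately have edge: "closed_segment u v edge_of P" using F(1) edge_of_def by blast
    have xo: "x \<in> open_segment u v" using F(2) uv by (simp add: rel_interior_closed_segment)
    then obtain t where t: "0 < t" "t < 1" "x = (1 - t) *\<^sub>R u + t *\<^sub>R v"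
      by (auto simp: in_segment)
    have "u \<noteq> x" "v \<noteq> x" using xo by (auto simp: open_segment_def)
    then have nb: "a \<bullet> u \<noteq> b" "a \<bullet> v \<noteq> b" using single uv(2) by auto
    have "(1 - t) * (a \<bullet> u - b) + t * (a \<bullet> v - b) = 0"
      using xH unfolding t(3) by (simp add: inner_simps algebra_simps)
    then have "(a \<bullet> u < b \<and> b < a \<bullet> v) \<or> (a \<bullet> v < b \<and> b < a \<bullet> u)"
      using t(1,2) nb
      by (smt (verit, ccfv_SIG) mult_pos_pos mult_pos_neg)
    then show thesis
      using that(2)[of u v] that(2)[of v u] edge xo
      by (auto simp: closed_segment_commute open_segment_commute)
  qed
qed

text \<open>
  The orientation from the negative to the positive side makes each crossing edge appear exactly
  once.
\<close>
definition crossing_edges :: "'a::euclidean_space set \<Rightarrow> 'a \<Rightarrow> real \<Rightarrow> ('a \<times> 'a) set" where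
  "crossing_edges P a b = {(u, v). closed_segment u v edge_of P \<and> a \<bullet> u < b \<and> b < a \<bullet> v}"

definition crossing_point :: "'a::euclidean_space \<Rightarrow> real \<Rightarrow> 'a \<times> 'a \<Rightarrow> 'a" where
  "crossing_point a b = (\<lambda>(u, v). u + ((b - a \<bullet> u) / (a \<bullet> v - a \<bullet> u)) *\<^sub>R (v - u))"

lemma crossing_point_unique:
  fixes u v :: "'a::euclidean_space"
  assumes "a \<bullet> u < b" "b < a \<bullet> v"
  shows "closed_segment u v \<inter> {x. a \<bullet> x = b} = {crossing_point a b (u, v)}"
    and "crossing_point a b (u, v) \<in> open_segment u v"
proof -
  let ?t = "(b - a \<bullet> u) / (a \<bullet> v - a \<bullet> u)"
  have t: "0 < ?t" "?t < 1" using assms by auto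
  have cp: "crossing_point a b (u, v) = (1 - ?t) *\<^sub>R u + ?t *\<^sub>R v"
    by (simp add: crossing_point_def algebra_simps)
  have "u \<noteq> v" using assms by auto
  then show open': "crossing_point a b (u, v) \<in> open_segment u v"
    unfolding cp in_segment using t by blast
  have "a \<bullet> crossing_point a b (u, v) = a \<bullet> u + ?t * (a \<bullet> v - a \<bullet> u)"
    by (simp add: crossing_point_def inner_simps)
  also have "\<dots> = b" using assms by simp
  finally have on: "a \<bullet> crossing_point a b (u, v) = b" .
  have "x = crossing_point a b (u, v)" if "x \<in> closed_segment u v" "a \<bullet> x = b" for x
  proof -
    obtain s where s: "x = (1 - s) *\<^sub>R u + s *\<^sub>R v" using \<open>x \<in> closed_segment u v\<close>
      by (auto simp: in_segment)
    have "s * (a \<bullet> v - a \<bullet> u) = b - a \<bullet> u"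
      using \<open>a \<bullet> x = b\<close> unfolding s by (simp add: inner_simps algebra_simps)
    then have "s = ?t" using assms by (simp add: field_simps)
    then show ?thesis using s cp by simp
  qed
  then show "closed_segment u v \<inter> {x. a \<bullet> x = b} = {crossing_point a b (u, v)}"
    using on open' by (auto simp: open_segment_def)
qed

lemma finite_vertices:
  fixes P :: "'a::euclidean_space set"
  assumes "polytope P" shows "finite (vertices P)"
  unfolding vertices_def
  by (rule finite_polyhedron_extreme_points[OF polytope_imp_polyhedron[OF assms]])

lemma crossing_edges_subset: "crossing_edges P a b \<subseteq> vertices P \<times> vertices P"
  unfolding crossing_edges_def vertices_def edge_of_def using segment_face_of by blast

text \<open>
  Distinct crossing edges have disjoint relative interiors, so they contribute distinct points,
  and none of these is a vertex of the polytope.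
\<close>
theorem card_vertices_slice:
  fixes P :: "'a::euclidean_space set"
  assumes P: "polytope P"
  shows "card (vertices ({x. a \<bullet> x = b} \<inter> P))
       = card {v \<in> vertices P. a \<bullet> v = b} + card (crossing_edges P a b)"
proof -
  let ?H = "{x. a \<bullet> x = b}" and ?c = "crossing_point a b"
  let ?C = "crossing_edges P a b" and ?Z = "{v \<in> vertices P. a \<bullet> v = b}"
  have cross: "closed_segment u v face_of P" "aff_dim (closed_segment u v) = 1"
      "a \<bullet> u < b" "b < a \<bullet> v" if "(u, v) \<in> ?C" for u v
    using that by (auto simp: crossing_edges_def edge_of_def)
  have rel: "?c (u, v) \<in> rel_interior (closed_segment u v)" if "(u, v) \<in> ?C" for u v
    using crossing_point_unique(2)[OF cross(3,4)[OF that]] cross(3,4)[OF that]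
    by (auto simp: rel_interior_closed_segment)
  have "vertices (?H \<inter> P) = ?Z \<union> ?c ` ?C"
  proof (intro equalityI subsetI)
    fix x assume "x \<in> vertices (?H \<inter> P)"
    then have "x extreme_point_of (?H \<inter> P)" by (simp add: vertices_def)
    moreover from this have "a \<bullet> x = b" by (simp add: extreme_point_of_def)
    ultimately consider "x extreme_point_of P"
      | u v where "closed_segment u v edge_of P" "a \<bullet> u < b" "b < a \<bullet> v" "x \<in> open_segment u v"
      using extreme_point_of_slice_cases[OF P] by metis
    then show "x \<in> ?Z \<union> ?c ` ?C"
    proof cases
      case (2 u v)
      then have "x = ?c (u, v)"
        using crossing_point_unique(1)[OF 2(2,3)] \<open>a \<bullet> x = b\<close> by (auto simp: open_segment_def)
      moreover have "(u, v) \<in> ?C" using 2 by (simp add: crossing_edges_def)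
      ultimately show ?thesis by blast
    qed (use \<open>a \<bullet> x = b\<close> in \<open>simp add: vertices_def\<close>)
  next
    fix x assume "x \<in> ?Z \<union> ?c ` ?C"
    then show "x \<in> vertices (?H \<inter> P)"
    proof
      assume "x \<in> ?Z"
      then show ?thesis by (auto simp: vertices_def extreme_point_of_def)
    next
      assume "x \<in> ?c ` ?C"
      then obtain u v where uv: "(u, v) \<in> ?C" "x = ?c (u, v)" by auto
      have "(closed_segment u v \<inter> ?H) face_of (P \<inter> ?H)"
        using cross(1)[OF uv(1)] by (intro face_of_slice convex_hyperplane)
      then show ?thesis
        using crossing_point_unique(1)[OF cross(3,4)[OF uv(1)]] uv(2)
        by (simp add: vertices_def face_of_singleton Int_commute)
    qed
  qed
  moreover have "inj_on ?c ?C"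
  proof (rule inj_onI, clarify)
    fix u v u' v' assume *: "(u, v) \<in> ?C" "(u', v') \<in> ?C" "?c (u, v) = ?c (u', v')"
    then have "closed_segment u v = closed_segment u' v'"
      using rel[OF *(1)] rel[OF *(2)] *(3)
      by (intro face_of_eq[OF cross(1)[OF *(1)] cross(1)[OF *(2)]]) auto
    then have "{u, v} = {u', v'}"
      by (simp add: closed_segment_eq)
    then show "u = u' \<and> v = v'"
      using cross(3,4)[OF *(1)] cross(3,4)[OF *(2)] by (auto simp: doubleton_eq_iff)
  qed
  moreover have "?Z \<inter> ?c ` ?C = {}"
  proof -
    have False if "(u, v) \<in> ?C" "?c (u, v) extreme_point_of P" for u v
    proof -
      have "u \<in> P" "v \<in> P" using cross(1)[OF that(1)] face_of_imp_subset by auto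
      then show False
        using that(2) crossing_point_unique(2)[OF cross(3,4)[OF that(1)]]
        by (auto simp: extreme_point_of_def)
    qed
    then show ?thesis by (auto simp: vertices_def)
  qed
  moreover have "finite ?C"
    using finite_subset[OF crossing_edges_subset] finite_vertices[OF P] by auto
  ultimately show ?thesis
    using finite_vertices[OF P] by (simp add: card_Un_disjoint card_image)
qed

text \<open>
  Hence \<open>max_slice\<close> is the maximum of a finite set.
\<close>
corollary finite_VSS:
  fixes P :: "'a::euclidean_space set"
  assumes "polytope P" shows "finite (VSS P)"
proof -
  let ?V = "vertices P"
  have fin: "finite ?V" "finite (?V \<times> ?V)" using finite_vertices[OF assms] by auto
  have "cv P H \<le> card ?V + card (?V \<times> ?V)" if H: "H \<in> slicing_hyperplanes P" for H
  proof -
    obtain a b where "H = {x. a \<bullet> x = b}"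
      using H unfolding slicing_hyperplanes_def affine_hyperplane_def by blast
    then show ?thesis
      using card_vertices_slice[OF assms, of a b]
        card_mono[OF fin(2) crossing_edges_subset[of P a b]]
        card_mono[OF fin(1), of "{v \<in> ?V. a \<bullet> v = b}"]
      unfolding cv_def by auto
  qed
  then have "VSS P \<subseteq> {..card ?V + card (?V \<times> ?V)}" unfolding VSS_def by auto
  then show ?thesis using finite_subset by blast
qed

section \<open>Edges and vertices of a polytope\<close>

lemma segment_edge_of_convex_hullI:
  fixes V :: "'a::euclidean_space set"
  assumes fin: "finite V" and uv: "u \<in> V" "v \<in> V" "u \<noteq> v"
    and ab: "a \<bullet> u = b" "a \<bullet> v = b" "\<forall>w \<in> V - {u, v}. b < a \<bullet> w"
  shows "closed_segment u v edge_of (convex hull V)"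
proof -
  let ?P = "convex hull V"
  have "V \<subseteq> {x. a \<bullet> x \<ge> b}" using ab by (force simp: order_le_less)
  then have "?P \<subseteq> {x. a \<bullet> x \<ge> b}" by (simp add: hull_minimal convex_halfspace_ge)
  then have face: "(?P \<inter> {x. a \<bullet> x = b}) face_of ?P"
    by (intro face_of_Int_supporting_hyperplane_ge) auto
  then obtain V' where V': "V' \<subseteq> V" "?P \<inter> {x. a \<bullet> x = b} = convex hull V'"
    by (rule face_of_convex_hull_subset[OF finite_imp_compact[OF fin]])
  have "V' \<subseteq> {u, v}"
  proof
    fix w assume "w \<in> V'"
    then have "a \<bullet> w = b" using V' hull_inc[of w V' convex] by auto
    then show "w \<in> {u, v}" using ab(3) V'(1) \<open>w \<in> V'\<close> by force
  qed
  then have "convex hull V' \<subseteq> closed_segment u v" by (simp add: segment_convex_hull hull_mono)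
  moreover have "closed_segment u v \<subseteq> ?P \<inter> {x. a \<bullet> x = b}"
    using ab uv by (simp add: closed_segment_subset convex_hyperplane hull_inc)
  ultimately have "closed_segment u v face_of ?P" using face V' by auto
  moreover have "aff_dim (closed_segment u v) = 1"
    using uv(3) by (simp add: segment_convex_hull aff_dim_convex_hull aff_dim_2)
  ultimately show "closed_segment u v edge_of ?P" by (simp add: edge_of_def)
qed

text \<open>
  Faces of polytopes are exposed, and an extreme point on the segment is one of its ends; this
  gives the functional.
\<close>
lemma segment_edge_of_convex_hull_iff:
  fixes V :: "'a::euclidean_space set"
  assumes fin: "finite V" and V: "vertices (convex hull V) = V" and uv: "u \<in> V" "v \<in> V" "u \<noteq> v"
  shows "closed_segment u v edge_of (convex hull V) \<longleftrightarrow>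
    (\<exists>a b. a \<bullet> u = b \<and> a \<bullet> v = b \<and> (\<forall>w \<in> V - {u, v}. b < a \<bullet> w))"
proof
  let ?P = "convex hull V"
  assume "closed_segment u v edge_of ?P"
  then have face: "closed_segment u v face_of ?P" by (simp add: edge_of_def)
  moreover have "polyhedron ?P" by (simp add: fin polyhedron_convex_hull)
  ultimately obtain a b where ab: "?P \<subseteq> {x. a \<bullet> x \<le> b}" "closed_segment u v = ?P \<inter> {x. a \<bullet> x = b}"
    using exposed_face_of_polyhedron[of ?P "closed_segment u v"] unfolding exposed_face_of_def by blast
  have "a \<bullet> w < b" if "w \<in> V - {u, v}" for w
  proof (rule ccontr)
    assume "\<not> a \<bullet> w < b"
    then have "w \<in> closed_segment u v" using ab that hull_inc[of w V convex] by auto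
    moreover have "w extreme_point_of ?P" using V that by (auto simp: vertices_def)
    ultimately have "w extreme_point_of closed_segment u v"
      using extreme_point_of_face[OF face] by blast
    then show False using that by (auto simp: extreme_point_of_segment)
  qed
  moreover have "a \<bullet> u = b" "a \<bullet> v = b" using ab by auto
  ultimately have "(- a) \<bullet> u = - b \<and> (- a) \<bullet> v = - b \<and> (\<forall>w \<in> V - {u, v}. - b < (- a) \<bullet> w)" by simp
  then show "\<exists>a b. a \<bullet> u = b \<and> a \<bullet> v = b \<and> (\<forall>w \<in> V - {u, v}. b < a \<bullet> w)" by blast
qed (elim exE conjE, rule segment_edge_of_convex_hullI[OF fin uv])

text \<open>
  Vertices are the atoms of the face lattice, which makes their number an invariant of the
  lattice.
\<close>
lemma singleton_face_iff_minimal: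
  fixes P :: "'a::euclidean_space set"
  assumes "polytope P" "F face_of P"
  shows "(\<exists>v. F = {v}) \<longleftrightarrow> F \<noteq> {} \<and> (\<forall>G. G face_of P \<longrightarrow> G \<subseteq> F \<longrightarrow> G = {} \<or> G = F)"
proof
  assume "F \<noteq> {} \<and> (\<forall>G. G face_of P \<longrightarrow> G \<subseteq> F \<longrightarrow> G = {} \<or> G = F)"
  moreover have "compact F" "convex F"
    using face_of_polytope_polytope[OF assms] polytope_imp_compact polytope_imp_convex by auto
  moreover from calculation obtain v where "v extreme_point_of F"
    using extreme_point_exists_convex[of F] by blast
  moreover from this have "{v} face_of P" "{v} \<subseteq> F"
    using extreme_point_of_face[OF assms(2)] by (auto simp: face_of_singleton extreme_point_of_def)
  ultimately show "\<exists>v. F = {v}" by blast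
qed (auto simp: subset_singleton_iff)

lemma combinatorially_equivalent_card_vertices:
  fixes P :: "'a::euclidean_space set" and Q :: "'b::euclidean_space set"
  assumes P: "polytope P" and Q: "polytope Q" and eq: "combinatorially_equivalent P Q"
  shows "card (vertices P) = card (vertices Q)"
proof -
  obtain f where bij: "bij_betw f {F. F face_of P} {F. F face_of Q}"
    and ord: "\<And>F G. F face_of P \<Longrightarrow> G face_of P \<Longrightarrow> F \<subseteq> G \<longleftrightarrow> f F \<subseteq> f G"
    using eq unfolding combinatorially_equivalent_def by blast
  have into: "f F face_of Q" if "F face_of P" for F
    using bij_betwE[OF bij] that by blast
  have onto: "\<exists>F. F face_of P \<and> f F = G" if "G face_of Q" for G
  proof -
    have "G \<in> f ` {F. F face_of P}" using bij_betw_imp_surj_on[OF bij] that by simp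
    then show ?thesis by auto
  qed
  have inj: "f F = f G \<longleftrightarrow> F = G" if "F face_of P" "G face_of P" for F G
    using ord[OF that] ord[OF that(2,1)] by blast
  have f0: "f {} = {}"
  proof -
    obtain F where "F face_of P" "f F = {}" using onto[of "{}"] by auto
    then show ?thesis using ord[of "{}" F] by auto
  qed
  have single: "(\<exists>v. F = {v}) \<longleftrightarrow> (\<exists>w. f F = {w})" if F: "F face_of P" for F
  proof -
    have "(\<forall>G. G face_of P \<longrightarrow> G \<subseteq> F \<longrightarrow> G = {} \<or> G = F) \<longleftrightarrow>
          (\<forall>G. G face_of P \<longrightarrow> f G \<subseteq> f F \<longrightarrow> f G = {} \<or> f G = f F)"
    proof -
      have "f G \<subseteq> f F \<longleftrightarrow> G \<subseteq> F" "f G = {} \<longleftrightarrow> G = {}" "f G = f F \<longleftrightarrow> G = F"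
        if "G face_of P" for G
        using ord[OF that F] inj[OF that F] inj[OF that empty_face_of] f0 by simp_all
      then show ?thesis by simp
    qed
    also have "\<dots> \<longleftrightarrow> (\<forall>G. G face_of Q \<longrightarrow> G \<subseteq> f F \<longrightarrow> G = {} \<or> G = f F)"
      using onto into by blast
    finally show ?thesis
      using singleton_face_iff_minimal[OF P F] singleton_face_iff_minimal[OF Q into[OF F]] inj[OF F, of "{}"] f0
      by simp
  qed
  have sing: "{F. F face_of R \<and> (\<exists>v. F = {v})} = (\<lambda>v. {v}) ` vertices R" for R :: "'c::euclidean_space set"
    by (auto simp: vertices_def face_of_singleton)
  have "bij_betw f {F. F face_of P \<and> (\<exists>v. F = {v})} {F. F face_of Q \<and> (\<exists>v. F = {v})}"
    unfolding bij_betw_def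
  proof
    show "inj_on f {F. F face_of P \<and> (\<exists>v. F = {v})}" using inj by (auto simp: inj_on_def)
    show "f ` {F. F face_of P \<and> (\<exists>v. F = {v})} = {F. F face_of Q \<and> (\<exists>v. F = {v})}"
    proof (intro equalityI subsetI)
      fix G assume G: "G \<in> {F. F face_of Q \<and> (\<exists>v. F = {v})}"
      then obtain F where "F face_of P" "f F = G" using onto by blast
      then show "G \<in> f ` {F. F face_of P \<and> (\<exists>v. F = {v})}" using G single by blast
    qed (use into single in blast)
  qed
  then have "card ((\<lambda>v. {v}) ` vertices P) = card ((\<lambda>v. {v}) ` vertices Q)"
    unfolding sing by (rule bij_betw_same_card)
  then show ?thesis by (simp add: card_image)
qed

section \<open>The capped bipyramid and affine functionals on its vertices\<close>

text \<open>
  Names for the vertices, so that combinatorial statements avoid coordinates. \<open>Rim t\<close>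
  is a vertex for \<open>t \<le> n\<close> only.
\<close>
datatype node = Apex | Nadir | Cap | Rim nat

definition nodes :: "nat \<Rightarrow> node set" where
  "nodes n = {Apex, Nadir, Cap} \<union> Rim ` {..n}"

text \<open>
  The edges, each in one of its two orientations, so that the cardinality of a subset counts
  edges. The step from \<open>Rim 1\<close> to \<open>Rim 2\<close> is left out since the cap
  covers it.
\<close>
definition links :: "nat \<Rightarrow> (node \<times> node) set" where
  "links n = (\<lambda>t. (Apex, Rim t)) ` {..n} \<union> (\<lambda>t. (Nadir, Rim t)) ` {..n}
     \<union> {(Apex, Cap), (Cap, Rim 1), (Cap, Rim 2)}
     \<union> (\<lambda>t. (Rim t, Rim (Suc t))) ` ({..<n} - {1}) \<union> {(Rim n, Rim 0)}"

text \<open>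
  The midpoint of the apices is \<open>(1, 3, 0) = 2/3 p\<^sub>0 + 1/3 p\<^sub>3\<close>. The cap
  satisfies \<open>9 Cap = 5 p\<^sub>1 + 5 p\<^sub>2 - Nadir\<close>: it lies on the ray from the
  nadir through the midpoint of \<open>p\<^sub>1 p\<^sub>2\<close>, so close behind this chord
  that, of the facets of the bipyramid, it is beyond \<open>Apex p\<^sub>1 p\<^sub>2\<close> only,
  in the plane of \<open>Nadir p\<^sub>1 p\<^sub>2\<close>, and beneath the others.
\<close>
definition point :: "node \<Rightarrow> real ^ 3" where
  "point x = (case x of
      Apex \<Rightarrow> vector [1, 3, 9]
    | Nadir \<Rightarrow> vector [1, 3, - 9]
    | Cap \<Rightarrow> vector [14 / 9, 22 / 9, 1]
    | Rim t \<Rightarrow> vector [real t, (real t)\<^sup>2, 0])"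

definition affine_values :: "(node \<Rightarrow> real) \<Rightarrow> bool" where
  "affine_values g \<longleftrightarrow> (\<exists>a b. \<forall>x. g x = a \<bullet> point x - b)"

text \<open>
  The values of the functional \<open>\<alpha> + \<beta> x + \<gamma> y + \<delta> z\<close> at
  the points, in which \<open>\<alpha>\<close>, \<open>\<beta>\<close>, \<open>\<gamma>\<close>
  are the coefficients of an arbitrary quadratic polynomial on the rim.
\<close>
definition values_at :: "real \<Rightarrow> real \<Rightarrow> real \<Rightarrow> real \<Rightarrow> node \<Rightarrow> real" where
  "values_at \<alpha> \<beta> \<gamma> \<delta> x = (case x of
      Apex \<Rightarrow> \<alpha> + \<beta> + 3 * \<gamma> + 9 * \<delta>
    | Nadir \<Rightarrow> \<alpha> + \<beta> + 3 * \<gamma> - 9 * \<delta>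
    | Cap \<Rightarrow> \<alpha> + 14 / 9 * \<beta> + 22 / 9 * \<gamma> + \<delta>
    | Rim t \<Rightarrow> \<alpha> + \<beta> * real t + \<gamma> * (real t)\<^sup>2)"

lemma values_at_simps [simp]:
  "values_at \<alpha> \<beta> \<gamma> \<delta> Apex = \<alpha> + \<beta> + 3 * \<gamma> + 9 * \<delta>"
  "values_at \<alpha> \<beta> \<gamma> \<delta> Nadir = \<alpha> + \<beta> + 3 * \<gamma> - 9 * \<delta>"
  "values_at \<alpha> \<beta> \<gamma> \<delta> Cap = \<alpha> + 14 / 9 * \<beta> + 22 / 9 * \<gamma> + \<delta>"
  "values_at \<alpha> \<beta> \<gamma> \<delta> (Rim t) = \<alpha> + \<beta> * real t + \<gamma> * (real t)\<^sup>2"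
  by (simp_all add: values_at_def)

lemma inner_point:
  "a \<bullet> point x - b = values_at (- b) (a $ 1) (a $ 2) (a $ 3) x"
  by (cases x) (simp_all add: point_def inner_vec_def sum_3)

lemma affine_values_values_at: "affine_values (values_at \<alpha> \<beta> \<gamma> \<delta>)"
  unfolding affine_values_def inner_point
  by (intro exI[of _ "vector [\<beta>, \<gamma>, \<delta>]"] exI[of _ "- \<alpha>"]) simp

lemma affine_valuesE:
  assumes "affine_values g"
  obtains \<alpha> \<beta> \<gamma> \<delta> where "g = values_at \<alpha> \<beta> \<gamma> \<delta>"
  using assms unfolding affine_values_def inner_point by (metis ext)

lemma affine_values_uminus:
  assumes "affine_values g" shows "affine_values (\<lambda>x. - g x)"
proof -
  obtain a b where "\<forall>x. g x = a \<bullet> point x - b"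
    using assms unfolding affine_values_def by blast
  then show ?thesis unfolding affine_values_def
    by (intro exI[of _ "- a"] exI[of _ "- b"]) auto
qed

text \<open>
  The crossing diagonals of the quadrilateral facet at the cap.
\<close>
lemma affine_values_cap:
  assumes "affine_values g"
  shows "9 * g Cap = 5 * (g (Rim 1) + g (Rim 2)) - g Nadir"
  using assms by (auto elim!: affine_valuesE simp: field_simps)

text \<open>
  The midpoint of the apices is a convex combination of \<open>Rim 0\<close> and
  \<open>Rim 3\<close>.
\<close>
lemma affine_values_midpoint:
  assumes "affine_values g"
  shows "g Apex + g Nadir = 4 / 3 * g (Rim 0) + 2 / 3 * g (Rim 3)"
  using assms by (auto elim!: affine_valuesE simp: field_simps)

section \<open>Zeros and sign changes of a quadratic polynomial\<close>

text \<open>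
  How often a line meets the boundary of the rim polygon, in terms of the values of a functional
  at its corners.
\<close>
definition cyclic_crossings :: "nat \<Rightarrow> (nat \<Rightarrow> real) \<Rightarrow> nat" where
  "cyclic_crossings n q = (\<Sum>t\<le>n. of_bool (q t = 0))
     + (\<Sum>t<n. of_bool (q t * q (Suc t) < 0)) + of_bool (q n * q 0 < 0)"

text \<open>
  Each zero and each sign change along the path gives its own root in \<open>[0, n]\<close>, of
  which there are at most two. If the closing edge is crossed, then the values at the two ends
  have opposite signs, and two distinct roots in \<open>[0, n]\<close> would make their product
  nonnegative.
\<close>
lemma cyclic_crossings_quadratic_le_2:
  fixes q :: "nat \<Rightarrow> real"
  assumes q: "\<And>t. q t = \<alpha> + \<beta> * real t + \<gamma> * (real t)\<^sup>2"
    and nz: "\<alpha> \<noteq> 0 \<or> \<beta> \<noteq> 0 \<or> \<gamma> \<noteq> 0"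
  shows "cyclic_crossings n q \<le> 2"
proof -
  define p where "p = [:\<alpha>, \<beta>, \<gamma>:]"
  have p: "poly p x = \<alpha> + \<beta> * x + \<gamma> * x\<^sup>2" for x
    by (simp add: p_def power2_eq_square algebra_simps)
  have qp: "q t = poly p (real t)" for t by (simp add: p q)
  have "p \<noteq> 0" using nz by (auto simp: p_def)
  define Z where "Z = {t \<in> {..n}. q t = 0}"
  define C where "C = {t \<in> {..<n}. q t * q (Suc t) < 0}"
  have "\<exists>x. real t < x \<and> x < real (Suc t) \<and> poly p x = 0" if "t \<in> C" for t
    using that poly_IVT[of "real t" "real (Suc t)" p] by (auto simp: C_def qp)
  then obtain \<rho> where \<rho>: "real t < \<rho> t" "\<rho> t < real (Suc t)" "poly p (\<rho> t) = 0"
    if "t \<in> C" for t by metis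
  define R where "R = real ` Z \<union> \<rho> ` C"
  have finR: "finite R" by (simp add: R_def Z_def C_def)
  have card_R: "card R = card Z + card C"
  proof -
    have "inj_on \<rho> C"
    proof (rule inj_onI)
      fix s t assume *: "s \<in> C" "t \<in> C" "\<rho> s = \<rho> t"
      have "real s < real (Suc t)" "real t < real (Suc s)"
        using \<rho>[OF *(1)] \<rho>[OF *(2)] *(3) by linarith+
      then show "s = t" by simp
    qed
    moreover have "real ` Z \<inter> \<rho> ` C = {}"
    proof -
      have False if "t \<in> C" "real s = \<rho> t" for s t
      proof -
        have "real t < real s" "real s < real (Suc t)" using \<rho>[OF that(1)] that(2) by linarith+
        then show False by simp
      qed
      then show ?thesis by blast
    qed
    ultimately show ?thesis unfolding R_def
      by (subst card_Un_disjoint) (auto simp: card_image Z_def C_def)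
  qed
  have R0: "poly p x = 0" "0 \<le> x" "x \<le> real n" if "x \<in> R" for x
  proof -
    have "poly p x = 0 \<and> 0 \<le> x \<and> x \<le> real n"
      using that unfolding R_def
    proof
      assume "x \<in> \<rho> ` C"
      then obtain t where t: "t \<in> C" "x = \<rho> t" by auto
      then have "real (Suc t) \<le> real n" by (simp add: C_def)
      then show ?thesis using \<rho>[OF t(1)] t(2) of_nat_0_le_iff[of t, where 'a=real] by auto
    qed (auto simp: Z_def qp)
    then show "poly p x = 0" "0 \<le> x" "x \<le> real n" by auto
  qed
  have "card R \<le> card {x. poly p x = 0}"
    using R0 poly_roots_finite[OF \<open>p \<noteq> 0\<close>] by (intro card_mono) auto
  also have "\<dots> \<le> 2"
    using card_poly_roots_bound[OF \<open>p \<noteq> 0\<close>] by (auto simp: p_def split: if_splits)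
  finally have R2: "card R \<le> 2" .
  \<comment> \<open>Vieta: \<open>q n * q 0\<close> is \<open>\<gamma>\<^sup>2\<close> times a product of
    four nonnegative factors.\<close>
  have R1: "card R \<le> 1" if "q n * q 0 < 0"
  proof -
    have "r = s" if "r \<in> R" "s \<in> R" for r s
    proof (rule ccontr)
      assume "r \<noteq> s"
      have "\<alpha> + \<beta> * r + \<gamma> * r\<^sup>2 = 0" "\<alpha> + \<beta> * s + \<gamma> * s\<^sup>2 = 0"
        using R0(1)[OF that(1)] R0(1)[OF that(2)] p by simp_all
      moreover from this have "(r - s) * (\<beta> + \<gamma> * (r + s)) = 0"
        by (simp add: algebra_simps power2_eq_square)
      then have b: "\<beta> = - \<gamma> * (r + s)" using \<open>r \<noteq> s\<close> by simp
      ultimately have a: "\<alpha> = \<gamma> * (r * s)" by (simp add: algebra_simps power2_eq_square)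
      have "q n * q 0 = \<gamma>\<^sup>2 * (r * s) * ((real n - r) * (real n - s))"
        unfolding q a b by (simp add: algebra_simps power2_eq_square)
      also have "\<dots> \<ge> 0" using R0(2,3) that by (intro mult_nonneg_nonneg) auto
      finally show False using \<open>q n * q 0 < 0\<close> by simp
    qed
    then show ?thesis using card_le_Suc0_iff_eq[OF finR] by auto
  qed
  have "(\<Sum>t\<le>n. of_bool (q t = 0)) = card Z" "(\<Sum>t<n. of_bool (q t * q (Suc t) < 0)) = card C"
    by (simp_all add: Z_def C_def Int_def)
  then have "cyclic_crossings n q = card R + of_bool (q n * q 0 < 0)"
    unfolding cyclic_crossings_def card_R by simp
  then show ?thesis using R1 R2 by (cases "q n * q 0 < 0") auto
qed

section \<open>Counting the vertices of a slice by signs\<close>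

text \<open>
  By \<open>card_vertices_slice\<close>, the number of vertices of the slice by the zero plane of
  a functional with the values \<open>g\<close>.
\<close>
definition slice_count :: "nat \<Rightarrow> (node \<Rightarrow> real) \<Rightarrow> nat" where
  "slice_count n g = card {x \<in> nodes n. g x = 0} + card {(x, y) \<in> links n. g x * g y < 0}"

lemma finite_nodes: "finite (nodes n)" and finite_links: "finite (links n)"
  by (simp_all add: nodes_def links_def)

text \<open>
  The missing edge from \<open>Rim 1\<close> to \<open>Rim 2\<close> is added on the left so that
  the whole boundary of the rim polygon can be counted at once on the right.
\<close>
lemma slice_count_eq:
  fixes g :: "node \<Rightarrow> real"
  assumes n: "2 \<le> n"
  shows "slice_count n g + of_bool (g (Rim 1) * g (Rim 2) < 0) =
    cyclic_crossings n (\<lambda>t. g (Rim t))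
    + (\<Sum>t\<le>n. of_bool (g Apex * g (Rim t) < 0) + of_bool (g Nadir * g (Rim t) < 0))
    + (of_bool (g Apex = 0) + of_bool (g Nadir = 0))
    + (of_bool (g Cap = 0) + of_bool (g Apex * g Cap < 0)
       + of_bool (g Cap * g (Rim 1) < 0) + of_bool (g Cap * g (Rim 2) < 0))"
proof -
  let ?c = "\<lambda>(x, y). of_bool (g x * g y < 0) :: nat"
  have "card {x \<in> nodes n. g x = 0} = (\<Sum>x\<in>nodes n. of_bool (g x = 0))"
    by (simp add: finite_nodes Int_def)
  also have "\<dots> = of_bool (g Apex = 0) + of_bool (g Nadir = 0) + of_bool (g Cap = 0)
      + (\<Sum>t\<le>n. of_bool (g (Rim t) = 0))"
    unfolding nodes_def
    by (subst sum.union_disjoint) (auto simp: sum.reindex inj_on_def simp del: sum_of_bool_eq)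
  finally have zeros: "card {x \<in> nodes n. g x = 0} = \<dots>" .
  have "card {(x, y) \<in> links n. g x * g y < 0} = card {e \<in> links n. g (fst e) * g (snd e) < 0}"
    by (rule arg_cong[of _ _ card]) auto
  also have "\<dots> = (\<Sum>e\<in>links n. of_bool (g (fst e) * g (snd e) < 0))"
    by (simp add: finite_links Int_def)
  also have "\<dots> = sum ?c (links n)" by (simp add: case_prod_beta)
  also have "\<dots> = (\<Sum>t\<le>n. of_bool (g Apex * g (Rim t) < 0)) + (\<Sum>t\<le>n. of_bool (g Nadir * g (Rim t) < 0))
      + (of_bool (g Apex * g Cap < 0) + of_bool (g Cap * g (Rim 1) < 0) + of_bool (g Cap * g (Rim 2) < 0))
      + (\<Sum>t\<in>{..<n} - {1}. of_bool (g (Rim t) * g (Rim (Suc t)) < 0)) + of_bool (g (Rim n) * g (Rim 0) < 0)"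
  proof -
    have s1: "sum ?c ((\<lambda>t. (Apex, Rim t)) ` {..n}) = (\<Sum>t\<le>n. of_bool (g Apex * g (Rim t) < 0))"
      by (subst sum.reindex) (auto simp: inj_on_def)
    have s2: "sum ?c ((\<lambda>t. (Nadir, Rim t)) ` {..n}) = (\<Sum>t\<le>n. of_bool (g Nadir * g (Rim t) < 0))"
      by (subst sum.reindex) (auto simp: inj_on_def)
    have s3: "sum ?c ((\<lambda>t. (Rim t, Rim (Suc t))) ` ({..<n} - {1}))
        = (\<Sum>t\<in>{..<n} - {1}. of_bool (g (Rim t) * g (Rim (Suc t)) < 0))"
      by (subst sum.reindex) (auto simp: inj_on_def)
    show ?thesis
      unfolding links_def
      apply (subst sum.union_disjoint, simp, simp, use n in force)
      apply (subst sum.union_disjoint, simp, simp, force)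
      apply (subst sum.union_disjoint, simp, simp, force)
      apply (subst sum.union_disjoint, simp, simp, force)
      unfolding s1 s2 s3 by simp
  qed
  finally have crossings: "card {(x, y) \<in> links n. g x * g y < 0} = \<dots>" .
  have "(\<Sum>t<n. of_bool (g (Rim t) * g (Rim (Suc t)) < 0))
      = (of_bool (g (Rim 1) * g (Rim 2) < 0) :: nat)
        + (\<Sum>t\<in>{..<n} - {1}. of_bool (g (Rim t) * g (Rim (Suc t)) < 0))"
    using n by (subst sum.remove[of _ 1]) (auto simp: numeral_2_eq_2)
  then show ?thesis
    unfolding slice_count_def zeros crossings cyclic_crossings_def sum.distrib by simp
qed

lemma slice_count_uminus: "slice_count n (\<lambda>x. - g x) = slice_count n g"
  by (simp add: slice_count_def)

text \<open>
  No rim vertex is strictly separated from both apices, so the spokes contribute at most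
  \<open>n + 1\<close>, and everything else is bounded by a constant.
\<close>
lemma slice_count_apices_separated:
  assumes g: "affine_values g" and n: "8 \<le> n" and AB: "g Apex * g Nadir \<le> 0"
  shows "slice_count n g < 2 * n + 2"
proof -
  obtain \<alpha> \<beta> \<gamma> where q: "\<And>t. g (Rim t) = \<alpha> + \<beta> * real t + \<gamma> * (real t)\<^sup>2"
    using g by (auto elim!: affine_valuesE)
  let ?spokes = "\<Sum>t\<le>n. of_bool (g Apex * g (Rim t) < 0) + of_bool (g Nadir * g (Rim t) < 0) :: nat"
  have rim: "cyclic_crossings n (\<lambda>t. g (Rim t)) + ?spokes \<le> n + 3"
  proof (cases "\<alpha> = 0 \<and> \<beta> = 0 \<and> \<gamma> = 0")
    case True
    then show ?thesis by (simp add: q cyclic_crossings_def)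
  next
    case False
    have "?spokes \<le> (\<Sum>t\<le>n. 1)"
    proof (rule sum_mono)
      fix t
      have "\<not> (g Apex * g (Rim t) < 0 \<and> g Nadir * g (Rim t) < 0)"
        using AB by (auto simp: mult_less_0_iff mult_le_0_iff)
      then show "of_bool (g Apex * g (Rim t) < 0) + of_bool (g Nadir * g (Rim t) < 0) \<le> (1::nat)"
        by auto
    qed
    then have "?spokes \<le> n + 1" by simp
    moreover have "cyclic_crossings n (\<lambda>t. g (Rim t)) \<le> 2"
      using False by (intro cyclic_crossings_quadratic_le_2[of _ \<alpha> \<beta> \<gamma>] q) auto
    ultimately show ?thesis by simp
  qed
  have "of_bool (g Cap = 0) + of_bool (g Apex * g Cap < 0)
       + of_bool (g Cap * g (Rim 1) < 0) + of_bool (g Cap * g (Rim 2) < 0) \<le> (3::nat)"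
    by (cases "g Cap = 0") auto
  moreover have "of_bool (g Apex = 0) + of_bool (g Nadir = 0) \<le> (2::nat)" by auto
  ultimately have "slice_count n g \<le> n + 8"
    using slice_count_eq[of n g] n rim by linarith
  then show ?thesis using n by linarith
qed

text \<open>
  Let \<open>k\<close> be the number of negative rim vertices. The spokes contribute
  \<open>2 k\<close>, the boundary of the rim polygon at most 2, and the cap at most 3; if
  \<open>Rim 1\<close> or \<open>Rim 2\<close> is negative, then the cap adds at most 1 to what
  the chord between them accounts for. This gives at most \<open>2 n + 1\<close> for
  \<open>k \<le> n - 2\<close>. Since the midpoint of the apices is positive and close to
  \<open>Rim 0\<close>, a larger \<open>k\<close> forces \<open>Rim 0\<close> to be positive. For
  \<open>k = n - 1\<close> this leaves one other nonnegative rim vertex, so the smaller bound for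
  the cap applies and gives \<open>2 n + 1\<close> again. For \<open>k = n\<close> the two rim
  edges at \<open>Rim 0\<close> and the edge from the apex to the cap are crossed.
\<close>
lemma slice_count_apices_positive:
  assumes g: "affine_values g" and n: "5 \<le> n" and A: "0 < g Apex" and B: "0 < g Nadir"
  shows "(\<forall>t\<in>{1..n}. g (Rim t) < 0) \<Longrightarrow> 2 * n + 3 \<le> slice_count n g"
    and "\<not> (\<forall>t\<in>{1..n}. g (Rim t) < 0) \<Longrightarrow> slice_count n g < 2 * n + 2"
proof -
  obtain \<alpha> \<beta> \<gamma> where q: "\<And>t. g (Rim t) = \<alpha> + \<beta> * real t + \<gamma> * (real t)\<^sup>2"
    using g by (auto elim!: affine_valuesE)
  have cap: "9 * g Cap = 5 * (g (Rim 1) + g (Rim 2)) - g Nadir"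
    by (rule affine_values_cap[OF g])
  have mid: "0 < 2 * g (Rim 0) + g (Rim 3)"
    using affine_values_midpoint[OF g] A B by argo
  define N where "N = {t \<in> {..n}. g (Rim t) < 0}"
  define k where "k = card N"
  have count: "slice_count n g + of_bool (g (Rim 1) * g (Rim 2) < 0) =
      cyclic_crossings n (\<lambda>t. g (Rim t)) + 2 * k
      + (of_bool (g Cap = 0) + of_bool (g Cap < 0)
         + of_bool (g Cap * g (Rim 1) < 0) + of_bool (g Cap * g (Rim 2) < 0))"
  proof -
    have "(\<Sum>t\<le>n. of_bool (g Apex * g (Rim t) < 0) + of_bool (g Nadir * g (Rim t) < 0))
        = (\<Sum>t\<le>n. 2 * of_bool (g (Rim t) < 0) :: nat)"
      using A B by (intro sum.cong) (auto simp: mult_less_0_iff)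
    also have "\<dots> = 2 * k" by (simp add: sum_distrib_left[symmetric] k_def N_def Int_def)
    finally show ?thesis
      using slice_count_eq[of n g] n A B by (simp add: mult_less_0_iff)
  qed
  have finN: "finite N" by (simp add: N_def)
  show "2 * n + 3 \<le> slice_count n g" if neg: "\<forall>t\<in>{1..n}. g (Rim t) < 0"
  proof -
    have neg': "g (Rim 1) < 0" "g (Rim 2) < 0" "g (Rim 3) < 0" "g (Rim n) < 0" using neg n by auto
    then have pos: "0 < g (Rim 0)" using mid by linarith
    have "N = {1..n}"
    proof (intro equalityI subsetI)
      fix t assume "t \<in> N"
      then show "t \<in> {1..n}" using pos by (cases t) (auto simp: N_def)
    qed (use neg in \<open>auto simp: N_def\<close>)
    then have "k = n" by (simp add: k_def)
    have "of_bool (g (Rim 0) * g (Rim (Suc 0)) < 0) \<le> (\<Sum>t<n. of_bool (g (Rim t) * g (Rim (Suc t)) < 0) :: nat)"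
      using n by (intro member_le_sum) auto
    then have "2 \<le> cyclic_crossings n (\<lambda>t. g (Rim t))"
      unfolding cyclic_crossings_def using pos neg' by (simp add: mult_less_0_iff)
    moreover have "g Cap < 0" using cap neg'(1,2) B by argo
    moreover have "\<not> g (Rim 1) * g (Rim 2) < 0" using neg' by (simp add: mult_less_0_iff)
    ultimately show ?thesis using count \<open>k = n\<close> by simp
  qed
  show "slice_count n g < 2 * n + 2" if nonneg: "\<not> (\<forall>t\<in>{1..n}. g (Rim t) < 0)"
  proof -
    have "\<alpha> \<noteq> 0 \<or> \<beta> \<noteq> 0 \<or> \<gamma> \<noteq> 0" using mid by (auto simp: q)
    then have cyc: "cyclic_crossings n (\<lambda>t. g (Rim t)) \<le> 2"
      by (intro cyclic_crossings_quadratic_le_2[of _ \<alpha> \<beta> \<gamma>] q)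
    have extra3: "of_bool (g Cap = 0) + of_bool (g Cap < 0)
         + of_bool (g Cap * g (Rim 1) < 0) + of_bool (g Cap * g (Rim 2) < 0) \<le> (3::nat)"
      by (cases "g Cap = 0") auto
    have extra1: "of_bool (g Cap = 0) + of_bool (g Cap < 0)
         + of_bool (g Cap * g (Rim 1) < 0) + of_bool (g Cap * g (Rim 2) < 0)
         \<le> 1 + (of_bool (g (Rim 1) * g (Rim 2) < 0) :: nat)"
      if "g (Rim 1) < 0 \<or> g (Rim 2) < 0"
    proof -
      have "g Cap < 0" if "g (Rim 1) < 0" "g (Rim 2) < 0" using that cap B by argo
      then show ?thesis using that
        by (cases "g Cap" "0 :: real" rule: linorder_cases;
            cases "g (Rim 1)" "0 :: real" rule: linorder_cases;
            cases "g (Rim 2)" "0 :: real" rule: linorder_cases)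
          (auto simp: mult_less_0_iff)
    qed
    show ?thesis
    proof (cases "k \<le> n - 2")
      case True
      then show ?thesis using count cyc extra3 n by linarith
    next
      case False
      have "0 < g (Rim 0)"
      proof (rule ccontr)
        assume "\<not> 0 < g (Rim 0)"
        then have q0: "\<alpha> \<le> 0" and q3: "0 < \<alpha> + (\<beta> + 3 * \<gamma>)" using mid by (auto simp: q)
        have "k \<le> n - 2"
        \<comment> \<open>With \<open>g (Rim u) = \<alpha> + u (\<beta> + \<gamma> u)\<close> and
          \<open>\<alpha> \<le> 0\<close>, the factor \<open>\<beta> + \<gamma> u\<close> exceeds
          \<open>- \<alpha>\<close> at 3, as the midpoint is positive, and hence for all \<open>u\<close>
          on one side of 3.\<close>
        proof (cases "\<gamma> \<le> 0")
          case True
          have "N \<subseteq> {..n} - {1, 2, 3}"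
            using q0 q3 True by (auto simp: N_def q)
          then have "k \<le> card ({..n} - {1, 2, 3})" unfolding k_def by (intro card_mono) auto
          also have "\<dots> = n - 2" using n by (subst card_Diff_subset) auto
          finally show ?thesis .
        next
          case False
          have "0 \<le> g (Rim t)" if "3 \<le> t" for t
          proof -
            have "3 * \<gamma> \<le> real t * \<gamma>" using that False by (intro mult_right_mono) auto
            then have "- \<alpha> \<le> \<beta> + \<gamma> * real t" using q3 by (simp add: mult.commute)
            moreover have "- \<alpha> * 1 \<le> - \<alpha> * real t" using that q0 by (intro mult_left_mono) auto
            moreover have "- \<alpha> * real t \<le> (\<beta> + \<gamma> * real t) * real t"
              using calculation(1) by (intro mult_right_mono) auto
            ultimately show ?thesis by (simp add: q algebra_simps power2_eq_square)
          qed
          then have "N \<subseteq> {..<3}" by (auto simp: N_def not_le[symmetric])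
          then have "k \<le> card {..<3::nat}" unfolding k_def by (intro card_mono) auto
          then show ?thesis using n by simp
        qed
        with \<open>\<not> k \<le> n - 2\<close> show False by simp
      qed
      have sub: "N \<subseteq> {1..n}"
      proof
        fix t assume "t \<in> N"
        then show "t \<in> {1..n}" using \<open>0 < g (Rim 0)\<close> by (cases t) (auto simp: N_def)
      qed
      moreover have "N \<noteq> {1..n}" using nonneg by (auto simp: N_def)
      ultimately have "k < n" unfolding k_def using psubset_card_mono[of "{1..n}" N] by auto
      moreover have "g (Rim 1) < 0 \<or> g (Rim 2) < 0"
      proof (rule ccontr)
        assume *: "\<not> (g (Rim 1) < 0 \<or> g (Rim 2) < 0)"
        have "N \<subseteq> {1..n} - {1, 2}" using sub * by (auto simp: N_def)
        then have "k \<le> card ({1..n} - {1, 2})" unfolding k_def by (intro card_mono) auto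
        also have "\<dots> = n - 2" using n by (subst card_Diff_subset) auto
        finally show False using False by simp
      qed
      ultimately show ?thesis using count cyc extra1 n by linarith
    qed
  qed
qed

theorem slice_count_gap:
  assumes g: "affine_values g" and n: "8 \<le> n"
  shows "slice_count n g \<noteq> 2 * n + 2"
proof -
  have pos: "slice_count n h \<noteq> 2 * n + 2"
    if "affine_values h" "0 < h Apex" "0 < h Nadir" for h
    using slice_count_apices_positive[of h n] that n by fastforce
  consider "g Apex * g Nadir \<le> 0" | "0 < g Apex" "0 < g Nadir" | "g Apex < 0" "g Nadir < 0"
    by (auto simp: mult_le_0_iff) linarith
  then show ?thesis
  proof cases
    case 1
    then show ?thesis using slice_count_apices_separated[OF g n] by simp
  next
    case 2
    then show ?thesis using pos[OF g] by blast
  next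
    case 3
    then show ?thesis
      using pos[OF affine_values_uminus[OF g]] by (simp add: slice_count_uminus)
  qed
qed

section \<open>Edges of the capped bipyramid\<close>

definition capped_bipyramid :: "nat \<Rightarrow> (real ^ 3) set" where
  "capped_bipyramid n = convex hull (point ` nodes n)"

lemma inj_point: "inj point"
proof (rule injI)
  fix x y assume "point x = point y"
  then have "point x $ i = point y $ i" for i by simp
  from this[of 1] this[of 2] this[of 3] show "x = y"
    by (cases x; cases y) (simp_all add: point_def)
qed

lemma polytope_capped_bipyramid: "polytope (capped_bipyramid n)"
  by (simp add: capped_bipyramid_def polytope_convex_hull finite_nodes)

lemma mem_links:
  "(Apex, Rim t) \<in> links n \<longleftrightarrow> t \<le> n"
  "(Nadir, Rim t) \<in> links n \<longleftrightarrow> t \<le> n"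
  "(Apex, Cap) \<in> links n"
  "(Cap, Rim t) \<in> links n \<longleftrightarrow> t = 1 \<or> t = 2"
  "(Rim s, Rim t) \<in> links n \<longleftrightarrow> s < n \<and> s \<noteq> 1 \<and> t = Suc s \<or> s = n \<and> t = 0"
  "(x, Apex) \<notin> links n" "(x, Nadir) \<notin> links n"
  "(Nadir, Cap) \<notin> links n" "(Cap, Cap) \<notin> links n" "(Rim s, Cap) \<notin> links n"
  by (auto simp: links_def)

lemma links_subset_nodes:
  assumes "2 \<le> n" shows "links n \<subseteq> nodes n \<times> nodes n"
proof (intro subrelI)
  fix x y assume "(x, y) \<in> links n"
  then show "(x, y) \<in> nodes n \<times> nodes n"
    using assms by (cases x; cases y) (auto simp: mem_links nodes_def)
qed

lemma links_asym: "2 \<le> n \<Longrightarrow> (x, y) \<in> links n \<Longrightarrow> (y, x) \<notin> links n"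
  by (cases x; cases y) (auto simp: mem_links)

lemma links_irrefl: "2 \<le> n \<Longrightarrow> (x, x) \<notin> links n"
  using links_asym by metis

text \<open>
  The criterion of \<open>segment_edge_of_convex_hull_iff\<close> in terms of values at the nodes.
\<close>
definition exposed_pair :: "nat \<Rightarrow> node \<Rightarrow> node \<Rightarrow> bool" where
  "exposed_pair n x y \<longleftrightarrow> (\<exists>g. affine_values g \<and> g x = 0 \<and> g y = 0 \<and>
     (\<forall>z \<in> nodes n - {x, y}. 0 < g z))"

lemma exposed_pairI:
  assumes "values_at \<alpha> \<beta> \<gamma> \<delta> x = 0" "values_at \<alpha> \<beta> \<gamma> \<delta> y = 0"
    and "\<And>z. z \<in> {Apex, Nadir, Cap} - {x, y} \<Longrightarrow> 0 < values_at \<alpha> \<beta> \<gamma> \<delta> z"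
    and "\<And>u. u \<le> n \<Longrightarrow> Rim u \<noteq> x \<Longrightarrow> Rim u \<noteq> y \<Longrightarrow> 0 < values_at \<alpha> \<beta> \<gamma> \<delta> (Rim u)"
  shows "exposed_pair n x y"
  unfolding exposed_pair_def
proof (intro exI[of _ "values_at \<alpha> \<beta> \<gamma> \<delta>"] conjI ballI affine_values_values_at assms(1,2))
  fix z assume "z \<in> nodes n - {x, y}"
  then show "0 < values_at \<alpha> \<beta> \<gamma> \<delta> z"
    using assms(3)[of z] assms(4) unfolding nodes_def by blast
qed

text \<open>
  For each edge, a quadratic polynomial on the rim that is positive away from the edge, and a
  slope \<open>\<delta>\<close> that adjusts the values at the apices and the cap.
\<close>
lemma links_exposed:
  assumes n: "4 \<le> n" and xy: "(x, y) \<in> links n"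
  shows "exposed_pair n x y"
proof -
  have sq: "0 < (real u - real t)\<^sup>2" if "u \<noteq> t" for u t using that by simp
  have apex: "exposed_pair n Apex (Rim t)" for t
  \<comment> \<open>The square of \<open>u - t\<close> would make the value at the cap negative for
    \<open>t = 2\<close>; moving one root to 5/2 repairs this.\<close>
  proof (cases "t = 2")
    case True
    have "0 < (real u - 2) * (2 * real u - 5)" if "u \<noteq> 2" for u
    proof (cases "u \<le> 1")
      case True
      then show ?thesis by (intro mult_neg_neg) auto
    next
      case False
      then have "3 \<le> u" using that by linarith
      then have "3 \<le> real u" by simp
      then show ?thesis by (intro mult_pos_pos) auto
    qed
    then show ?thesis unfolding True
      by (intro exposed_pairI[where \<alpha> = 5 and \<beta> = "- 9 / 2" and \<gamma> = 1 and \<delta> = "- 7 / 18"])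
        (auto simp: algebra_simps power2_eq_square)
  next
    case False
    have cap: "0 < 8 * (real t)\<^sup>2 - 26 * real t + 19"
    proof -
      consider "t = 0" | "t = 1" | "3 \<le> t" using False by linarith
      then show ?thesis
      proof cases
        case 3
        then have "0 \<le> (real t - 3) * (8 * real t - 2)" by (intro mult_nonneg_nonneg) auto
        then show ?thesis by (simp add: algebra_simps power2_eq_square)
      qed auto
    qed
    have "0 < (real t - 1)\<^sup>2 + 2" by (intro add_nonneg_pos) auto
    then show ?thesis using sq[of _ t] cap
      by (intro exposed_pairI[where \<alpha> = "(real t)\<^sup>2" and \<beta> = "- 2 * real t" and \<gamma> = 1
            and \<delta> = "- ((real t)\<^sup>2 - 2 * real t + 3) / 9"])
        (auto simp: field_simps power2_eq_square)
  qed
  have nadir: "exposed_pair n Nadir (Rim t)" for t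
  proof -
    have "0 < 10 * (real t - 3 / 2)\<^sup>2 + 5 / 2" by (intro add_nonneg_pos) auto
    moreover have "0 < (real t - 1)\<^sup>2 + 2" by (intro add_nonneg_pos) auto
    ultimately show ?thesis using sq[of _ t]
      by (intro exposed_pairI[where \<alpha> = "(real t)\<^sup>2" and \<beta> = "- 2 * real t" and \<gamma> = 1
            and \<delta> = "((real t)\<^sup>2 - 2 * real t + 3) / 9"])
        (auto simp: field_simps power2_eq_square)
  qed
  have apex_cap: "exposed_pair n Apex Cap"
  proof -
    have "0 < (real u - 3 / 2)\<^sup>2 + 1 / 4" for u by (intro add_nonneg_pos) auto
    then show ?thesis
      by (intro exposed_pairI[where \<alpha> = "5 / 2" and \<beta> = "- 3" and \<gamma> = 1 and \<delta> = "- 5 / 18"])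
        (auto simp: algebra_simps power2_eq_square)
  qed
  have cap1: "exposed_pair n Cap (Rim 1)"
  proof -
    have "0 < (real u - 1) * (2 * real u - 3)" if "u \<noteq> 1" for u
    proof (cases "u = 0")
      case False
      then have "2 \<le> u" using that by linarith
      then have "2 \<le> real u" by simp
      then show ?thesis by (intro mult_pos_pos) auto
    qed simp
    then show ?thesis
      by (intro exposed_pairI[where \<alpha> = "3 / 2" and \<beta> = "- 5 / 2" and \<gamma> = 1 and \<delta> = "- 1 / 18"])
        (auto simp: algebra_simps power2_eq_square)
  qed
  have cap2: "exposed_pair n Cap (Rim 2)"
    using sq[of _ 2]
    by (intro exposed_pairI[where \<alpha> = 4 and \<beta> = "- 4" and \<gamma> = 1 and \<delta> = "- 2 / 9"])
      (auto simp: algebra_simps power2_eq_square)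
  have path: "exposed_pair n (Rim t) (Rim (Suc t))" if "t \<noteq> 1" for t
  proof -
    have "0 < 9 * (real t)\<^sup>2 - 19 * real t + 8"
    proof (cases "t = 0")
      case False
      then have "0 \<le> (real t - 2) * (9 * real t - 1)" using that by (intro mult_nonneg_nonneg) auto
      then show ?thesis by (simp add: algebra_simps power2_eq_square)
    qed simp
    moreover have "0 < (real t - 1 / 2)\<^sup>2 + 7 / 4" by (intro add_nonneg_pos) auto
    moreover have "0 < (real u - real t) * (real u - real t - 1)" if "u \<noteq> t" "u \<noteq> Suc t" for u
      using that by (auto simp: zero_less_mult_iff)
    ultimately show ?thesis
      by (intro exposed_pairI[where \<alpha> = "real t * (real t + 1)" and \<beta> = "- (2 * real t + 1)"
            and \<gamma> = 1 and \<delta> = 0])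
        (auto simp: field_simps power2_eq_square)
  qed
  have closing: "exposed_pair n (Rim n) (Rim 0)"
  proof -
    have "0 < real u * (real n - real u)" if "u \<le> n" "u \<noteq> 0" "u \<noteq> n" for u using that by simp
    then show ?thesis using n
      by (intro exposed_pairI[where \<alpha> = 0 and \<beta> = "real n" and \<gamma> = "- 1" and \<delta> = 0])
        (auto simp: algebra_simps power2_eq_square)
  qed
  show ?thesis
    using xy apex nadir apex_cap cap1 cap2 path closing unfolding links_def by auto
qed

lemma exposed_pair_commute: "exposed_pair n x y \<longleftrightarrow> exposed_pair n y x"
  unfolding exposed_pair_def by (metis insert_commute)

text \<open>
  A quadratic polynomial that is zero at \<open>s\<close> and \<open>t\<close> and positive at the
  other integers of \<open>[0, n]\<close> has adjacent roots if it is convex, and the roots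
  \<open>0\<close> and \<open>n\<close> otherwise. The pair 1, 2 is excluded by the cap, since a
  segment from the cap to the nadir crosses this chord.
\<close>
lemma exposed_rim_pair:
  assumes n: "2 \<le> n" and st: "s < t" "t \<le> n" and ex: "exposed_pair n (Rim s) (Rim t)"
  shows "(Rim s, Rim t) \<in> links n \<or> (Rim t, Rim s) \<in> links n"
proof -
  obtain g where g: "affine_values g" and g0: "g (Rim s) = 0" "g (Rim t) = 0"
    and pos: "\<And>z. z \<in> nodes n - {Rim s, Rim t} \<Longrightarrow> 0 < g z"
    using ex unfolding exposed_pair_def by blast
  obtain \<alpha> \<beta> \<gamma> where q: "\<And>u. g (Rim u) = \<alpha> + \<beta> * real u + \<gamma> * (real u)\<^sup>2"
    using g by (auto elim!: affine_valuesE)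
  have rim: "0 < g (Rim u)" if "u \<le> n" "u \<noteq> s" "u \<noteq> t" for u
    using pos that by (auto simp: nodes_def)
  have "(real t - real s) * (\<beta> + \<gamma> * (real s + real t)) = 0"
    using g0 by (simp add: q algebra_simps power2_eq_square)
  then have b: "\<beta> = - \<gamma> * (real s + real t)" using st by simp
  have "\<alpha> = - (\<beta> * real s + \<gamma> * (real s)\<^sup>2)" using g0(1) by (simp add: q)
  then have a: "\<alpha> = \<gamma> * (real s * real t)"
    unfolding b by (simp add: algebra_simps power2_eq_square)
  have fac: "g (Rim u) = \<gamma> * ((real u - real s) * (real u - real t))" for u
    unfolding q a b by (simp add: algebra_simps power2_eq_square)
  show ?thesis
  proof (cases "0 < \<gamma>")
    case True
    have "t = Suc s"
    proof (rule ccontr)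
      assume "t \<noteq> Suc s"
      then have "Suc s < t" "0 < g (Rim (Suc s))" using st rim by auto
      then show False using True by (simp add: fac zero_less_mult_iff)
    qed
    moreover have "s \<noteq> 1"
    proof
      assume "s = 1"
      then have "9 * g Cap = - g Nadir"
        using affine_values_cap[OF g] g0 \<open>t = Suc s\<close> by (simp add: numeral_2_eq_2)
      moreover have "0 < g Cap" "0 < g Nadir" using pos by (auto simp: nodes_def)
      ultimately show False by argo
    qed
    ultimately show ?thesis using st by (auto simp: links_def)
  next
    case False
    have "s = 0"
    proof (rule ccontr)
      assume "s \<noteq> 0"
      then have "0 < \<gamma> * (real s * real t)" using rim[of 0] st fac[of 0] by simp
      moreover have "0 \<le> real s * real t" by simp
      ultimately show False using False by (simp add: zero_less_mult_iff)
    qed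
    moreover have "t = n"
    proof (rule ccontr)
      assume "t \<noteq> n"
      then have "0 < \<gamma> * ((real n - real s) * (real n - real t))" using rim[of n] st fac[of n] by simp
      moreover have "0 \<le> (real n - real s) * (real n - real t)" using st by simp
      ultimately show False using False by (simp add: zero_less_mult_iff)
    qed
    ultimately show ?thesis by (simp add: links_def)
  qed
qed

text \<open>
  If the functional is zero at the cap, then its value at the nadir is 5 times the sum of the
  values at \<open>Rim 1\<close> and \<open>Rim 2\<close>. A zero at another rim vertex bounds the
  value at the midpoint of the apices by interpolation, which makes the value at the apex
  negative.
\<close>
lemma not_exposed_cap_rim:
  assumes n: "3 \<le> n" and t: "t \<le> n" "t \<noteq> 1" "t \<noteq> 2"
  shows "\<not> exposed_pair n Cap (Rim t)"
proof
  assume "exposed_pair n Cap (Rim t)"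
  then obtain g where g: "affine_values g" and g0: "g Cap = 0" "g (Rim t) = 0"
    and pos: "\<And>z. z \<in> nodes n - {Cap, Rim t} \<Longrightarrow> 0 < g z"
    unfolding exposed_pair_def by blast
  obtain \<alpha> \<beta> \<gamma> \<delta> where q: "g = values_at \<alpha> \<beta> \<gamma> \<delta>" using g by (rule affine_valuesE)
  have q12: "0 < g (Rim 1)" "0 < g (Rim 2)" using pos n t by (auto simp: nodes_def)
  have "0 < g Apex" using pos by (simp add: nodes_def)
  then have M: "5 * (g (Rim 1) + g (Rim 2)) < g Apex + g Nadir"
    using affine_values_cap[OF g] g0 by argo
  show False
  proof (cases "t = 0")
    case True
    then show False using M q12 g0 by (simp add: q)
  next
    case False
    then have t3: "3 \<le> t" using t by linarith
    \<comment> \<open>Lagrange interpolation of the midpoint from \<open>Rim 1\<close>,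
      \<open>Rim 2\<close> and \<open>Rim t\<close>.\<close>
    have "(real t - 2) * ((real t - 1) * (g Apex + g Nadir)) =
        (real t - 2) * (2 * (real t + 1) * g (Rim 1)) - 4 * (real t - 1) * g (Rim 2) + 4 * g (Rim t)"
      by (simp add: q algebra_simps power2_eq_square)
    moreover have "0 \<le> 4 * (real t - 1) * g (Rim 2)"
      using q12 t3 by simp
    ultimately have "(real t - 2) * ((real t - 1) * (g Apex + g Nadir))
        \<le> (real t - 2) * (2 * (real t + 1) * g (Rim 1))"
      using g0(2) by linarith
    then have "(real t - 1) * (g Apex + g Nadir) \<le> 2 * (real t + 1) * g (Rim 1)"
      using t3 by simp
    also have "\<dots> \<le> 5 * (real t - 1) * g (Rim 1)"
      using q12 t3 by (intro mult_right_mono) auto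
    also have "\<dots> = (real t - 1) * (5 * g (Rim 1))" by (simp add: algebra_simps)
    finally have "(real t - 1) * (g Apex + g Nadir) \<le> (real t - 1) * (5 * g (Rim 1))" .
    then have "g Apex + g Nadir \<le> 5 * g (Rim 1)" using t3 by simp
    then show False using M q12 by argo
  qed
qed

text \<open>
  The segment between the apices crosses the diagonal from \<open>Rim 0\<close> to
  \<open>Rim 3\<close>; the segment from the nadir to the cap passes through the chord of
  \<open>Rim 1\<close> and \<open>Rim 2\<close>.
\<close>
lemma exposed_in_links:
  assumes n: "4 \<le> n" and xy: "x \<in> nodes n" "y \<in> nodes n" "x \<noteq> y" and ex: "exposed_pair n x y"
  shows "(x, y) \<in> links n \<or> (y, x) \<in> links n"
proof -
  have AB: "\<not> exposed_pair n Apex Nadir"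
  proof
    assume "exposed_pair n Apex Nadir"
    then obtain g where g: "affine_values g" "g Apex = 0" "g Nadir = 0"
      and pos: "\<And>z. z \<in> nodes n - {Apex, Nadir} \<Longrightarrow> 0 < g z"
      unfolding exposed_pair_def by blast
    have "0 < g (Rim 0)" "0 < g (Rim 3)" using pos n by (auto simp: nodes_def)
    then show False using affine_values_midpoint[OF g(1)] g(2,3) by argo
  qed
  have BD: "\<not> exposed_pair n Nadir Cap"
  proof
    assume "exposed_pair n Nadir Cap"
    then obtain g where g: "affine_values g" "g Nadir = 0" "g Cap = 0"
      and pos: "\<And>z. z \<in> nodes n - {Nadir, Cap} \<Longrightarrow> 0 < g z"
      unfolding exposed_pair_def by blast
    have "0 < g (Rim 1)" "0 < g (Rim 2)" using pos n by (auto simp: nodes_def)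
    then show False using affine_values_cap[OF g(1)] g(2,3) by argo
  qed
  have rims: "(Rim s, Rim t) \<in> links n \<or> (Rim t, Rim s) \<in> links n"
    if "s \<noteq> t" "s \<le> n" "t \<le> n" "exposed_pair n (Rim s) (Rim t)" for s t
    using that exposed_rim_pair[of n s t] exposed_rim_pair[of n t s] n
    by (cases "s < t") (auto simp: exposed_pair_commute)
  have cap: "t = 1 \<or> t = 2" if "exposed_pair n Cap (Rim t)" "t \<le> n" for t
    using that not_exposed_cap_rim[of n t] n by auto
  have hub: "(Apex, Rim t) \<in> links n" "(Nadir, Rim t) \<in> links n" if "t \<le> n" for t
    using that by (auto simp: links_def)
  have caps: "(Apex, Cap) \<in> links n" "(Cap, Rim 1) \<in> links n" "(Cap, Rim 2) \<in> links n"
    by (auto simp: links_def)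
  have ex': "exposed_pair n y x" using ex exposed_pair_commute by blast
  show ?thesis
    using xy ex ex' AB BD rims cap hub caps
    by (cases x; cases y) (auto simp: nodes_def dest!: cap)
qed

lemma exposed_pair_iff:
  "exposed_pair n x y \<longleftrightarrow> (\<exists>a b. a \<bullet> point x = b \<and> a \<bullet> point y = b \<and>
     (\<forall>w \<in> point ` nodes n - {point x, point y}. b < a \<bullet> w))"
proof -
  have "point ` nodes n - {point x, point y} = point ` (nodes n - {x, y})"
    using inj_point by (auto simp: inj_def)
  then have *: "(\<forall>w \<in> point ` nodes n - {point x, point y}. b < a \<bullet> w)
      \<longleftrightarrow> (\<forall>z \<in> nodes n - {x, y}. 0 < a \<bullet> point z - b)" for a b
    by simp
  show ?thesis
  proof
    assume "exposed_pair n x y"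
    then obtain g a b where "\<forall>z. g z = a \<bullet> point z - b" "g x = 0" "g y = 0"
        "\<forall>z \<in> nodes n - {x, y}. 0 < g z"
      unfolding exposed_pair_def affine_values_def by blast
    then show "\<exists>a b. a \<bullet> point x = b \<and> a \<bullet> point y = b \<and>
        (\<forall>w \<in> point ` nodes n - {point x, point y}. b < a \<bullet> w)"
      unfolding * by (intro exI[of _ a] exI[of _ b]) simp
  next
    assume "\<exists>a b. a \<bullet> point x = b \<and> a \<bullet> point y = b \<and>
        (\<forall>w \<in> point ` nodes n - {point x, point y}. b < a \<bullet> w)"
    then obtain a b where "a \<bullet> point x = b" "a \<bullet> point y = b"
        "\<forall>z \<in> nodes n - {x, y}. 0 < a \<bullet> point z - b"
      unfolding * by blast
    then show "exposed_pair n x y"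
      unfolding exposed_pair_def affine_values_def
      by (intro exI[of _ "\<lambda>z. a \<bullet> point z - b"]) auto
  qed
qed

lemma exposed_pair_imp_edge:
  assumes "x \<in> nodes n" "y \<in> nodes n" "x \<noteq> y" "exposed_pair n x y"
  shows "closed_segment (point x) (point y) edge_of (capped_bipyramid n)"
proof -
  obtain a b where ab: "a \<bullet> point x = b" "a \<bullet> point y = b"
      "\<forall>w \<in> point ` nodes n - {point x, point y}. b < a \<bullet> w"
    using assms(4) unfolding exposed_pair_iff by blast
  have ne: "point x \<noteq> point y" using assms(3) inj_point by (simp add: inj_eq)
  show ?thesis unfolding capped_bipyramid_def
    by (rule segment_edge_of_convex_hullI[OF finite_imageI[OF finite_nodes] _ _ ne ab])
      (use assms in simp_all)
qed

text \<open>
  Every node is an end of some edge, and the ends of an edge are vertices.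
\<close>
lemma vertices_capped_bipyramid:
  assumes n: "4 \<le> n" shows "vertices (capped_bipyramid n) = point ` nodes n"
proof (intro equalityI subsetI)
  fix v assume "v \<in> vertices (capped_bipyramid n)"
  then show "v \<in> point ` nodes n"
    using extreme_point_of_convex_hull[of v "point ` nodes n"]
    by (simp add: vertices_def capped_bipyramid_def)
next
  fix v assume "v \<in> point ` nodes n"
  then obtain x where x: "x \<in> nodes n" "v = point x" by blast
  have "(Apex, Cap) \<in> links n" "(Nadir, Rim 0) \<in> links n" "t \<le> n \<Longrightarrow> (Apex, Rim t) \<in> links n" for t
    by (auto simp: links_def)
  then have "\<exists>y. (x, y) \<in> links n \<or> (y, x) \<in> links n"
    using x(1) by (cases x) (auto simp: nodes_def)
  then obtain y where y: "(x, y) \<in> links n \<or> (y, x) \<in> links n" by blast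
  then have "exposed_pair n x y"
    using links_exposed[OF n, of x y] links_exposed[OF n, of y x] exposed_pair_commute[of n x y] by blast
  moreover have "y \<in> nodes n" "x \<noteq> y"
    using y links_subset_nodes[of n] links_irrefl[of n x] n by auto
  ultimately have "closed_segment (point x) (point y) face_of capped_bipyramid n"
    using exposed_pair_imp_edge[OF x(1)] by (simp add: edge_of_def)
  then have "point x extreme_point_of capped_bipyramid n" by (rule segment_face_of)
  then show "v \<in> vertices (capped_bipyramid n)"
    using x(2) by (simp add: vertices_def)
qed

lemma card_vertices_capped_bipyramid:
  assumes "4 \<le> n" shows "card (vertices (capped_bipyramid n)) = n + 4"
proof -
  have "card (vertices (capped_bipyramid n)) = card (nodes n)"
    using card_image[OF inj_on_subset[OF inj_point subset_UNIV], of "nodes n"]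
    by (simp add: vertices_capped_bipyramid[OF assms])
  also have "\<dots> = n + 4"
    unfolding nodes_def by (subst card_Un_disjoint) (auto simp: card_image inj_on_def)
  finally show ?thesis .
qed

lemma edge_of_capped_bipyramid_iff:
  assumes n: "4 \<le> n" and xy: "x \<in> nodes n" "y \<in> nodes n"
  shows "closed_segment (point x) (point y) edge_of (capped_bipyramid n)
     \<longleftrightarrow> (x, y) \<in> links n \<or> (y, x) \<in> links n"
proof (cases "x = y")
  case True
  then show ?thesis using links_irrefl[of n y] n by (simp add: edge_of_def)
next
  case False
  then have "point x \<noteq> point y" using inj_point by (simp add: inj_eq)
  then have "closed_segment (point x) (point y) edge_of (capped_bipyramid n) \<longleftrightarrow> exposed_pair n x y"
    unfolding exposed_pair_iff capped_bipyramid_def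
    using vertices_capped_bipyramid[OF n] xy
    by (intro segment_edge_of_convex_hull_iff) (simp_all add: finite_nodes capped_bipyramid_def)
  also have "\<dots> \<longleftrightarrow> (x, y) \<in> links n \<or> (y, x) \<in> links n"
    using exposed_in_links[OF n xy False] links_exposed[OF n] exposed_pair_commute by blast
  finally show ?thesis .
qed

lemma card_vertices_slice_capped_bipyramid:
  assumes n: "4 \<le> n"
  shows "card (vertices ({x. a \<bullet> x = b} \<inter> capped_bipyramid n))
       = slice_count n (\<lambda>x. a \<bullet> point x - b)"
proof -
  let ?g = "\<lambda>x. a \<bullet> point x - b"
  let ?C = "{(x, y) \<in> links n. ?g x * ?g y < 0}"
  let ?f = "\<lambda>(x, y). if ?g x < 0 then (point x, point y) else (point y, point x)"
  have inj: "point x = point y \<longleftrightarrow> x = y" for x y using inj_point by (simp add: inj_eq)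
  have "{v \<in> vertices (capped_bipyramid n). a \<bullet> v = b} = point ` {x \<in> nodes n. ?g x = 0}"
    using vertices_capped_bipyramid[OF n] by auto
  then have zeros: "card {v \<in> vertices (capped_bipyramid n). a \<bullet> v = b} = card {x \<in> nodes n. ?g x = 0}"
    using inj by (simp add: card_image inj_on_def)
  have "crossing_edges (capped_bipyramid n) a b = ?f ` ?C"
  proof (intro equalityI subsetI)
    fix e assume e: "e \<in> crossing_edges (capped_bipyramid n) a b"
    then obtain x y where xy: "x \<in> nodes n" "y \<in> nodes n" "e = (point x, point y)"
      using crossing_edges_subset[of "capped_bipyramid n" a b] vertices_capped_bipyramid[OF n] by blast
    have sgn: "?g x < 0" "0 < ?g y" and edge: "(x, y) \<in> links n \<or> (y, x) \<in> links n"
      using e edge_of_capped_bipyramid_iff[OF n xy(1,2)] unfolding xy(3) crossing_edges_def by auto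
    have prod: "?g x * ?g y < 0" "?g y * ?g x < 0" using sgn by (simp_all add: mult_less_0_iff)
    from edge show "e \<in> ?f ` ?C"
    proof
      assume "(x, y) \<in> links n"
      then show ?thesis using sgn prod xy(3) by (intro image_eqI[of _ _ "(x, y)"]) auto
    next
      assume "(y, x) \<in> links n"
      then show ?thesis using sgn prod xy(3) by (intro image_eqI[of _ _ "(y, x)"]) auto
    qed
  next
    fix e assume "e \<in> ?f ` ?C"
    then obtain x y where xy: "(x, y) \<in> links n" "?g x * ?g y < 0" "e = ?f (x, y)" by auto
    have "x \<in> nodes n" "y \<in> nodes n" using xy(1) links_subset_nodes[of n] n by auto
    then have edge: "closed_segment (point x) (point y) edge_of (capped_bipyramid n)"
        "closed_segment (point y) (point x) edge_of (capped_bipyramid n)"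
      using edge_of_capped_bipyramid_iff[OF n] xy(1) by auto
    show "e \<in> crossing_edges (capped_bipyramid n) a b"
      using xy(2,3) edge by (auto simp: crossing_edges_def mult_less_0_iff)
  qed
  moreover have "inj_on ?f ?C"
  proof (rule inj_onI)
    fix e e' assume e: "e \<in> ?C" "e' \<in> ?C" "?f e = ?f e'"
    obtain x y x' y' where xy: "e = (x, y)" "e' = (x', y')" by (metis surj_pair)
    have "(x = x' \<and> y = y') \<or> (x = y' \<and> y = x')"
      using e(3) unfolding xy by (auto simp: inj split: if_splits)
    moreover have "(y, x) \<notin> links n" "(x', y') \<in> links n"
      using e(1,2) links_asym[of n x y] n unfolding xy by auto
    ultimately show "e = e'" unfolding xy by blast
  qed
  ultimately have "card (crossing_edges (capped_bipyramid n) a b) = card ?C"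
    by (simp add: card_image)
  then show ?thesis
    using card_vertices_slice[OF polytope_capped_bipyramid, of a b n] zeros
    by (simp add: slice_count_def)
qed

text \<open>
  On the rim, a functional that vanishes at all vertices is a quadratic polynomial with three
  roots, so only its vertical slope remains, and the apex excludes that.
\<close>
lemma aff_dim_capped_bipyramid:
  assumes n: "2 \<le> n" shows "aff_dim (capped_bipyramid n) = 3"
proof (rule ccontr)
  assume "aff_dim (capped_bipyramid n) \<noteq> 3"
  then have "aff_dim (capped_bipyramid n) < DIM(real ^ 3)"
    using aff_dim_le_DIM[of "capped_bipyramid n"] by simp
  then obtain a b where a: "a \<noteq> 0" "capped_bipyramid n \<subseteq> {x. a \<bullet> x = b}"
    by (rule aff_lowdim_subset_hyperplane)
  then have "a \<bullet> point x - b = 0" if "x \<in> nodes n" for x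
    using that hull_subset[of "point ` nodes n" convex] by (auto simp: capped_bipyramid_def)
  then have *: "values_at (- b) (a $ 1) (a $ 2) (a $ 3) x = 0" if "x \<in> nodes n" for x
    using that inner_point by metis
  have "a $ 1 = 0 \<and> a $ 2 = 0 \<and> a $ 3 = 0"
    using *[of "Rim 0"] *[of "Rim 1"] *[of "Rim 2"] *[of Apex] n by (auto simp: nodes_def)
  then show False using a(1) by (simp add: vec_eq_iff forall_3)
qed

section \<open>The gap\<close>

text \<open>
  The polynomial \<open>t\<^sup>2 - (n + 2) t + n\<close> is positive at 0, negative at
  \<open>1, \<dots>, n\<close>, and has the value 1 at the midpoint of the apices, so a vertical
  plane attains the large case and the value \<open>2 n + 2\<close> lies below the maximum.
\<close>
lemma capped_bipyramid_gap:
  assumes n: "8 \<le> n" shows "is_gap (capped_bipyramid n) (2 * n + 2)"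
proof -
  let ?P = "capped_bipyramid n"
  have count: "cv ?P {x. a \<bullet> x = b} = slice_count n (\<lambda>x. a \<bullet> point x - b)" for a b
    using card_vertices_slice_capped_bipyramid[of n a b] n by (simp add: cv_def)
  have "2 * n + 2 \<notin> VSS ?P"
  proof
    assume "2 * n + 2 \<in> VSS ?P"
    then obtain H where H: "H \<in> slicing_hyperplanes ?P" "cv ?P H = 2 * n + 2"
      unfolding VSS_def by (metis imageE)
    then obtain a b where "H = {x. a \<bullet> x = b}"
      unfolding slicing_hyperplanes_def affine_hyperplane_def by blast
    then have "cv ?P {x. a \<bullet> x = b} = 2 * n + 2" using H by simp
    then have "slice_count n (\<lambda>x. a \<bullet> point x - b) = 2 * n + 2" using count by simp
    moreover have "affine_values (\<lambda>x. a \<bullet> point x - b)" unfolding affine_values_def by blast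
    ultimately show False using slice_count_gap n by blast
  qed
  moreover have "2 * n + 3 \<le> max_slice ?P"
  proof -
    let ?g = "values_at (real n) (- (real n + 2)) 1 0"
    obtain a b where ab: "\<And>x. ?g x = a \<bullet> point x - b"
      using affine_values_values_at unfolding affine_values_def by metis
    have neg: "?g (Rim t) < 0" if "t \<in> {1..n}" for t
    proof -
      have "0 \<le> (real t - 1) * (real n - real t)" using that by simp
      moreover have "0 < real t" using that by simp
      ultimately show ?thesis by (simp add: algebra_simps power2_eq_square)
    qed
    have "2 * n + 3 \<le> slice_count n ?g"
      using n neg by (intro slice_count_apices_positive affine_values_values_at) auto
    moreover have "?g = (\<lambda>x. a \<bullet> point x - b)" using ab by blast
    ultimately have big: "2 * n + 3 \<le> cv ?P {x. a \<bullet> x = b}" using count by simp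
    have "a \<noteq> 0"
    proof
      assume "a = 0"
      then show False using ab[of Apex] ab[of "Rim 1"] by simp
    qed
    moreover have "{x. a \<bullet> x = b} \<inter> ?P \<noteq> {}"
    proof
      assume "{x. a \<bullet> x = b} \<inter> ?P = {}"
      then show False using big by (simp add: cv_def vertices_def)
    qed
    ultimately have "{x. a \<bullet> x = b} \<in> slicing_hyperplanes ?P"
      unfolding slicing_hyperplanes_def affine_hyperplane_def by blast
    then have "cv ?P {x. a \<bullet> x = b} \<in> VSS ?P" by (simp add: VSS_def)
    then have "cv ?P {x. a \<bullet> x = b} \<le> max_slice ?P"
      unfolding max_slice_def by (intro Max_ge finite_VSS polytope_capped_bipyramid)
    then show ?thesis using big by linarith
  qed
  ultimately show ?thesis by (simp add: is_gap_def)
qed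

section \<open>Connectivity of the skeleton\<close>

definition adjacent :: "nat \<Rightarrow> (node \<times> node) set" where
  "adjacent n = links n \<union> (links n)\<inverse>"

lemma adjacent_sym: "(x, y) \<in> adjacent n \<Longrightarrow> (y, x) \<in> adjacent n"
  by (simp add: adjacent_def disj_commute)

lemma adjacent_simps:
  "(Rim t, Apex) \<in> adjacent n \<longleftrightarrow> t \<le> n"
  "(Rim t, Nadir) \<in> adjacent n \<longleftrightarrow> t \<le> n"
  "(Cap, Apex) \<in> adjacent n"
  "(Nadir, Rim t) \<in> adjacent n \<longleftrightarrow> t \<le> n"
  "(Cap, Rim t) \<in> adjacent n \<longleftrightarrow> t = 1 \<or> t = 2"
  "(Cap, Nadir) \<notin> adjacent n" "(Cap, Cap) \<notin> adjacent n"
  "t < n \<Longrightarrow> t \<noteq> 1 \<Longrightarrow> (Rim (Suc t), Rim t) \<in> adjacent n"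
  by (auto simp: adjacent_def mem_links)

lemma arcs_induced_skeleton:
  assumes n: "4 \<le> n" and W: "W \<subseteq> nodes n"
  shows "arcs_ends (with_proj (skeleton (capped_bipyramid n)) \<restriction> (point ` W))
     = map_prod point point ` (adjacent n \<inter> W \<times> W)"
proof -
  have "(point x, point y) \<in> parcs (skeleton (capped_bipyramid n)) \<longleftrightarrow> (x, y) \<in> adjacent n"
    if "x \<in> W" "y \<in> W" for x y
    using edge_of_capped_bipyramid_iff[OF n, of x y] that W by (auto simp: skeleton_def adjacent_def)
  then show ?thesis by (auto simp: arcs_ends_conv)
qed

lemma connected_via_hub:
  assumes n: "4 \<le> n" and W: "W \<subseteq> nodes n" and h: "h \<in> W"
    and reach: "\<And>x. x \<in> W \<Longrightarrow> (x, h) \<in> (adjacent n \<inter> W \<times> W)\<^sup>*"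
  shows "Digraph_Component.connected (with_proj (skeleton (capped_bipyramid n)) \<restriction> (point ` W))"
proof -
  let ?R = "adjacent n \<inter> W \<times> W"
  let ?A = "map_prod point point ` ?R"
  have "sym ?R" using adjacent_sym by (auto simp: sym_def)
  then have symR: "(x, y) \<in> ?R\<^sup>* \<Longrightarrow> (y, x) \<in> ?R\<^sup>*" for x y
    using sym_rtrancl by (meson symD)
  have lift: "(point x, point y) \<in> rtrancl_on (point ` W) (?A\<^sup>s)" if "(x, y) \<in> ?R\<^sup>*" "x \<in> W" for x y
    using that
  proof (induction rule: rtrancl_induct)
    case base
    then show ?case by simp
  next
    case (step y z)
    have "(point y, point z) \<in> ?A\<^sup>s" using step(2) by (auto simp: symcl_def)
    moreover have "point z \<in> point ` W" using step(2) by auto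
    ultimately show ?case using rtrancl_on_into_rtrancl_on step by metis
  qed
  have "(point x, point y) \<in> rtrancl_on (point ` W) (?A\<^sup>s)" if "x \<in> W" "y \<in> W" for x y
    using lift reach symR that by (meson rtrancl_trans)
  then show ?thesis
    using h unfolding connected_conv arcs_induced_skeleton[OF n W] by auto
qed

lemma not_connected_isolated:
  assumes n: "4 \<le> n" and W: "W \<subseteq> nodes n" and xz: "x \<in> W" "z \<in> W" "x \<noteq> z"
    and iso: "\<And>y. y \<in> W \<Longrightarrow> (x, y) \<notin> adjacent n"
  shows "\<not> Digraph_Component.connected (with_proj (skeleton (capped_bipyramid n)) \<restriction> (point ` W))"
proof
  let ?A = "map_prod point point ` (adjacent n \<inter> W \<times> W)"
  assume "Digraph_Component.connected (with_proj (skeleton (capped_bipyramid n)) \<restriction> (point ` W))"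
  then have "(point x, point z) \<in> rtrancl_on (point ` W) (?A\<^sup>s)"
    using xz unfolding connected_conv arcs_induced_skeleton[OF n W] by auto
  then have "point z = point x"
  proof (induction rule: rtrancl_on_induct)
    case (step y z)
    then have "(x, z') \<in> adjacent n \<or> (z', x) \<in> adjacent n" if "z = point z'" "z' \<in> W" for z'
      using that inj_point by (auto simp: symcl_def inj_eq)
    then show ?case using iso adjacent_sym step by blast
  qed simp
  then show False using xz inj_point by (simp add: inj_eq)
qed

text \<open>
  The apex, or else the nadir, is joined to all remaining rim vertices and serves as a hub. If
  both are removed, then nothing else is, and the rim remains as a path in which the cap bridges
  the step from \<open>Rim 1\<close> to \<open>Rim 2\<close>.
\<close>
lemma connected_minus_two:
  assumes n: "4 \<le> n" and Y: "Y \<subseteq> nodes n" "card Y < 3"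
  shows "Digraph_Component.connected (with_proj (skeleton (capped_bipyramid n)) \<restriction> (point ` (nodes n - Y)))"
proof -
  let ?W = "nodes n - Y"
  let ?R = "adjacent n \<inter> ?W \<times> ?W"
  have finY: "finite Y" using Y finite_nodes finite_subset by blast
  have rim: "Rim t \<in> nodes n \<longleftrightarrow> t \<le> n" for t by (auto simp: nodes_def)
  have hubs: "Apex \<in> nodes n" "Nadir \<in> nodes n" "Cap \<in> nodes n" by (auto simp: nodes_def)
  have big: "\<not> Z \<subseteq> Y" if "finite Z" "3 \<le> card Z" for Z
    using card_mono[OF finY, of Z] Y(2) that by auto
  consider (apex) "Apex \<notin> Y" | (nadir) "Apex \<in> Y" "Nadir \<notin> Y" | (rim) "Apex \<in> Y" "Nadir \<in> Y" by blast
  then show ?thesis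
  proof cases
    case apex
    have R: "(Rim t, Apex) \<in> ?R" if "Rim t \<in> ?W" for t
      using that apex hubs by (auto simp: adjacent_simps rim)
    show ?thesis
    proof (rule connected_via_hub[OF n, of _ Apex])
      fix x assume x: "x \<in> ?W"
      show "(x, Apex) \<in> ?R\<^sup>*"
      proof (cases x)
        case Nadir
        have "\<not> {Rim 0, Rim 1, Rim 2} \<subseteq> Y" by (rule big) auto
        then obtain t where t: "Rim t \<in> ?W" "t \<le> n" using n by (auto simp: rim)
        then have "(Nadir, Rim t) \<in> ?R" using x Nadir by (auto simp: adjacent_simps)
        then show ?thesis using R[OF t(1)] Nadir by (meson converse_rtrancl_into_rtrancl r_into_rtrancl)
      next
        case Cap
        then have "(Cap, Apex) \<in> ?R" using x apex hubs by (auto simp: adjacent_simps)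
        then show ?thesis using Cap by blast
      next
        case (Rim t)
        then show ?thesis using R[of t] x by blast
      qed auto
    qed (use apex hubs in auto)
  next
    case nadir
    have R: "(Rim t, Nadir) \<in> ?R" if "Rim t \<in> ?W" for t
      using that nadir hubs by (auto simp: adjacent_simps rim)
    show ?thesis
    proof (rule connected_via_hub[OF n, of _ Nadir])
      fix x assume x: "x \<in> ?W"
      show "(x, Nadir) \<in> ?R\<^sup>*"
      proof (cases x)
        case Cap
        have "\<not> {Apex, Rim 1, Rim 2} \<subseteq> Y" by (rule big) auto
        then have "Rim 1 \<notin> Y \<or> Rim 2 \<notin> Y" using nadir by simp
        then obtain t where "Rim t \<notin> Y" and t12: "t = 1 \<or> t = 2" by metis
        then have t: "Rim t \<in> ?W" using n by (auto simp: rim)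
        have "(Cap, Rim t) \<in> ?R" using x Cap t t12 by (simp add: adjacent_simps)
        then show ?thesis using R[OF t] Cap by (meson converse_rtrancl_into_rtrancl r_into_rtrancl)
      next
        case (Rim t)
        then show ?thesis using R[of t] x by blast
      qed (use x nadir in auto)
    qed (use nadir hubs in auto)
  next
    case rim
    have Y2: "Y = {Apex, Nadir}"
    proof (rule card_seteq[symmetric])
      show "card Y \<le> card {Apex, Nadir}" using Y by simp
    qed (use finY rim in auto)
    have W: "x \<in> ?W \<longleftrightarrow> x = Cap \<or> (\<exists>t\<le>n. x = Rim t)" for x by (auto simp: Y2 nodes_def)
    have R: "(Rim t, Rim 0) \<in> ?R\<^sup>*" if "t \<le> n" for t
      using that
    proof (induction t)
      case (Suc t)
      have "(Rim (Suc t), Rim t) \<in> ?R\<^sup>*"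
      proof (cases "t = 1")
        case True
        have "(Cap, Rim 1) \<in> adjacent n" "(Cap, Rim 2) \<in> adjacent n" by (simp_all add: adjacent_simps)
        then have "(Rim 2, Cap) \<in> ?R" "(Cap, Rim 1) \<in> ?R" 
          using n adjacent_sym by (auto simp: Y2 nodes_def)
        then have "(Rim 2, Rim 1) \<in> ?R\<^sup>*" by (meson converse_rtrancl_into_rtrancl r_into_rtrancl)
        then show ?thesis using True by (simp add: numeral_2_eq_2)
      next
        case False
        then have "(Rim (Suc t), Rim t) \<in> ?R" using Suc(2) by (auto simp: adjacent_simps Y2 nodes_def)
        then show ?thesis by blast
      qed
      then show ?case using Suc by (meson Suc_leD rtrancl_trans)
    qed simp
    show ?thesis
    proof (rule connected_via_hub[OF n, of _ "Rim 0"])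
      fix x assume "x \<in> ?W"
      then consider "x = Cap" | t where "t \<le> n" "x = Rim t" unfolding W by blast
      then show "(x, Rim 0) \<in> ?R\<^sup>*"
      proof cases
        case 1
        have "(Cap, Rim 1) \<in> ?R" using n by (auto simp: adjacent_simps Y2 nodes_def)
        then show ?thesis using R[of 1] n 1 by (meson converse_rtrancl_into_rtrancl le_trans one_le_numeral)
      next
        case 2
        then show ?thesis using R by blast
      qed
    qed (auto simp: Y2 nodes_def)
  qed
qed

lemma three_connected_capped_bipyramid:
  assumes n: "4 \<le> n"
  shows "k_connected 3 (with_proj (skeleton (capped_bipyramid n)))"
proof -
  have V: "pverts (skeleton (capped_bipyramid n)) = point ` nodes n"
    using vertices_capped_bipyramid[OF n] by (simp add: skeleton_def)
  have "card (point ` nodes n) = n + 4"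
    using card_vertices_capped_bipyramid[OF n] vertices_capped_bipyramid[OF n] by simp
  moreover have "Digraph_Component.connected (with_proj (skeleton (capped_bipyramid n)) \<restriction> (point ` nodes n - X))"
    if X: "X \<subseteq> point ` nodes n" "card X < 3" for X
  proof -
    obtain Y where Y: "Y \<subseteq> nodes n" "X = point ` Y" using X(1) by (meson subset_imageE)
    then have "card Y < 3" using X(2) inj_point by (metis card_image inj_on_subset subset_UNIV)
    moreover have "point ` nodes n - X = point ` (nodes n - Y)"
      using inj_point Y(2) by (simp add: image_set_diff)
    ultimately show ?thesis using connected_minus_two[OF n Y(1)] by simp
  qed
  ultimately show ?thesis by (simp add: k_connected_def V)
qed

lemma not_four_connected_capped_bipyramid:
  assumes n: "4 \<le> n"
  shows "\<not> k_connected 4 (with_proj (skeleton (capped_bipyramid n)))"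
proof
  assume conn: "k_connected 4 (with_proj (skeleton (capped_bipyramid n)))"
  have V: "pverts (skeleton (capped_bipyramid n)) = point ` nodes n"
    using vertices_capped_bipyramid[OF n] by (simp add: skeleton_def)
  let ?Y = "{Apex, Rim 1, Rim 2}"
  have "?Y \<subseteq> nodes n" using n by (auto simp: nodes_def)
  then have "point ` ?Y \<subseteq> point ` nodes n" by (rule image_mono)
  moreover have "card (point ` ?Y) < 4" by (rule le_less_trans[OF card_image_le]) auto
  moreover have "\<forall>X \<subseteq> point ` nodes n. card X < 4 \<longrightarrow> Digraph_Component.connected
      (with_proj (skeleton (capped_bipyramid n)) \<restriction> (point ` nodes n - X))"
    using conn unfolding k_connected_def with_proj_simps V by (rule conjunct2)
  ultimately have "Digraph_Component.connected
      (with_proj (skeleton (capped_bipyramid n)) \<restriction> (point ` nodes n - point ` ?Y))"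
    by (elim allE impE)
  moreover have "point ` nodes n - point ` ?Y = point ` (nodes n - ?Y)"
    using inj_point by (simp add: image_set_diff)
  moreover have "\<not> Digraph_Component.connected
      (with_proj (skeleton (capped_bipyramid n)) \<restriction> (point ` (nodes n - ?Y)))"
    by (rule not_connected_isolated[OF n, of _ Cap Nadir]) (auto simp: nodes_def adjacent_simps)
  ultimately show False by simp
qed

section \<open>Infinitely many polytopes with a gap\<close>

theorem theorem1p3:
  shows "\<exists>S :: (real ^ 3) set set.
    infinite S \<and>
    pairwise (\<lambda>P Q. \<not> combinatorially_equivalent P Q) S \<and>
    (\<forall>P \<in> S. polytope P \<and> aff_dim P = 3 \<and>
       k_connected 3 (with_proj (skeleton P)) \<and>
       \<not> k_connected 4 (with_proj (skeleton P)) \<and>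
       (\<exists>m. is_gap P m))"
proof (intro exI conjI)
  let ?S = "capped_bipyramid ` {8..}"
  have same: "m = n" if "8 \<le> m" "8 \<le> n" "card (vertices (capped_bipyramid m)) = card (vertices (capped_bipyramid n))" for m n
    using that by (simp add: card_vertices_capped_bipyramid)
  have "inj_on capped_bipyramid {8..}" using same by (intro inj_onI) auto
  then show "infinite ?S" by (simp add: finite_image_iff infinite_Ici)
  show "pairwise (\<lambda>P Q. \<not> combinatorially_equivalent P Q) ?S"
  proof (intro pairwiseI notI)
    fix P Q assume "P \<in> ?S" "Q \<in> ?S" "P \<noteq> Q" and equiv: "combinatorially_equivalent P Q"
    then obtain m n where mn: "8 \<le> m" "P = capped_bipyramid m" "8 \<le> n" "Q = capped_bipyramid n"
      by auto
    have "card (vertices P) = card (vertices Q)"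
      unfolding mn(2,4) by (rule combinatorially_equivalent_card_vertices)
        (use equiv polytope_capped_bipyramid in \<open>simp_all add: mn(2,4)\<close>)
    then have "m = n" using same mn by simp
    then show False using \<open>P \<noteq> Q\<close> mn by simp
  qed
  show "\<forall>P \<in> ?S. polytope P \<and> aff_dim P = 3 \<and>
       k_connected 3 (with_proj (skeleton P)) \<and>
       \<not> k_connected 4 (with_proj (skeleton P)) \<and> (\<exists>m. is_gap P m)"
  proof
    fix P assume "P \<in> ?S"
    then obtain n where n: "8 \<le> n" and P: "P = capped_bipyramid n" by auto
    have "2 \<le> n" "4 \<le> n" using n by simp_all
    then show "polytope P \<and> aff_dim P = 3 \<and>
       k_connected 3 (with_proj (skeleton P)) \<and>
       \<not> k_connected 4 (with_proj (skeleton P)) \<and> (\<exists>m. is_gap P m)"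
      unfolding P
      by (intro conjI polytope_capped_bipyramid aff_dim_capped_bipyramid
          three_connected_capped_bipyramid not_four_connected_capped_bipyramid
          exI[of _ "2 * n + 2"] capped_bipyramid_gap n)
  qed
qed

end
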